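(* Let $X$ be a Banach space, let $\Phi:\mathbb{T}\to\mathrm{End}(X)$ be a (strongly continuous) semigroup, and let $\mathcal{P}$ be the $X$-relation consisting of all pairs $(u,x)\in C^\infty_{\mathrm{loc}}(\mathbb{T},X)\times C^\infty_{\mathrm{loc}}(\mathbb{T},X)$ satisfying $$x(t)=\Phi(t)x(0)+\int_{(0,t]}\Phi(t-s)u(s)\,ds\qquad\forall t\in\mathbb{T}.$$ If $\Phi(1)$ is compact, then the following are equivalent: (a) $\mathcal{P}$ is stable. (b) If $(0,x)\in\mathcal{P}$ and $x(\cdot+1)=\lambda x(\cdot)$ for some $\lambda \in \mathbb{C}$ with $|\lambda|\ge1$, then $x=0$ as a function. (c) $\Phi(1)$ has no eigenvalue outside the open unit disk. (d) $\mathcal{P}$ is VIVO. (e) $\mathcal{P}$ is smoothly VIVO.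
   Context: All vector spaces are over $\mathbb{C}$. $\mathbb{T}$ is either $\mathbb{R}_{\ge0}$ or $\mathbb{Z}_{\ge0}$; when $\mathbb{T}=\mathbb{Z}_{\ge0}$ the integral is taken with respect to counting measure. $\mathrm{End}(X)$ is the space of bounded linear operators on $X$. A (strongly continuous) semigroup is a map $\Phi:\mathbb{T}\to\mathrm{End}(X)$ with $\Phi(0)=\mathrm{id}_X$, $\Phi(t+s)=\Phi(t)\Phi(s)$ for all $t,s\in\mathbb{T}$, and $t\mapsto\Phi(t)x$ continuous for every $x\in X$ (vacuous if $\mathbb{T}=\mathbb{Z}_{\ge0}$). $C^\infty_{\mathrm{loc}}(\mathbb{R}_{\ge0},X)$ is the space of smooth functions $\mathbb{R}_{\ge0}\to X$; $C^\infty_{\mathrm{loc}}(\mathbb{Z}_{\ge0},X)$ is the space of all sequences in $X$. An $X$-relation is a linear subspace of $C^\infty_{\mathrm{loc}}(\mathbb{T},X)\times C^\infty_{\mathrm{loc}}(\mathbb{T},X)$ (pairs (input, output)) invariant under translation in time. A function $f\in C^\infty_{\mathrm{loc}}(\mathbb{T},X)$ is vanishing if $\lim_{t\to\infty}f(t)=0$; for $\mathbb{T}=\mathbb{R}_{\ge0}$ it is smoothly vanishing if $\lim_{t\to\infty}\partial_t^kf(t)=0$ for all $k\ge0$; for $\mathbb{T}=\mathbb{Z}_{\ge0}$ "smoothly vanishing" is read as "vanishing". A relation $\mathcal{P}$ is stable if $y$ is vanishing whenever $(0,y)\in\mathcal{P}$; it is VIVO [smoothly VIVO] if for every $(u,y)\in\mathcal{P}$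 with $u$ vanishing [smoothly vanishing], $y$ is vanishing [smoothly vanishing]. *)

theory Defs
  imports "HOL-Analysis.Analysis"
begin

text \<open>
  Complex normed spaces. The distribution only has real ones, so complex scalar
  multiplication is added on top of a real normed space, compatibly with \<^const>\<open>scaleR\<close>.
  A complex Banach space is a type of sort \<open>{complex_normed_vector, banach}\<close>.
\<close>

class complex_normed_vector = real_normed_vector +
  fixes scaleC :: "complex \<Rightarrow> 'a \<Rightarrow> 'a" (infixr "*\<^sub>C" 75)
  assumes scaleC_add_right: "c *\<^sub>C (x + y) = c *\<^sub>C x + c *\<^sub>C y"
    and scaleC_add_left: "(c + d) *\<^sub>C x = c *\<^sub>C x + d *\<^sub>C x"
    and scaleC_scaleC: "c *\<^sub>C d *\<^sub>C x = (c * d) *\<^sub>C x"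
    and scaleC_of_real: "complex_of_real r *\<^sub>C x = r *\<^sub>R x"
    and norm_scaleC: "norm (c *\<^sub>C x) = cmod c * norm x"

instantiation complex :: complex_normed_vector
begin

definition scaleC_complex :: "complex \<Rightarrow> complex \<Rightarrow> complex"
  where "scaleC_complex c z = c * z"

instance
  by standard (auto simp: scaleC_complex_def algebra_simps norm_mult scaleR_conv_of_real)

end

definition bounded_clinear :: "('a::complex_normed_vector \<Rightarrow> 'a) \<Rightarrow> bool"
  where "bounded_clinear A \<longleftrightarrow> bounded_linear A \<and> (\<forall>c x. A (c *\<^sub>C x) = c *\<^sub>C A x)"

definition compact_operator :: "('a::complex_normed_vector \<Rightarrow> 'a) \<Rightarrow> bool"
  where "compact_operator A \<longleftrightarrow>
    bounded_clinear A \<and> (\<forall>B. bounded B \<longrightarrow> compact (closure (A ` B)))"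

definition eigenvalue_of :: "('a::complex_normed_vector \<Rightarrow> 'a) \<Rightarrow> complex \<Rightarrow> bool"
  where "eigenvalue_of A c \<longleftrightarrow> (\<exists>v. v \<noteq> 0 \<and> A v = c *\<^sub>C v)"

text \<open>
  The time domain is a set \<open>T\<close> of reals, either \<open>{0..}\<close> or \<open>\<nat>\<close>. A function on \<open>T\<close> is
  represented by a total function on the reals, of which only the values on \<open>T\<close> matter;
  two such representatives are the same function if they agree on \<open>T\<close>.
  For \<open>T = \<nat>\<close>, a discrete set, continuity on \<open>T\<close> holds automatically.
\<close>

definition strongly_continuous_semigroup ::
    "real set \<Rightarrow> (real \<Rightarrow> 'a::complex_normed_vector \<Rightarrow> 'a) \<Rightarrow> bool"
  where "strongly_continuous_semigroup T \<Phi> \<longleftrightarrow>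
    (\<forall>t\<in>T. bounded_clinear (\<Phi> t)) \<and>
    \<Phi> 0 = id \<and>
    (\<forall>t\<in>T. \<forall>s\<in>T. \<Phi> (t + s) = \<Phi> t \<circ> \<Phi> s) \<and>
    (\<forall>x. continuous_on T (\<lambda>t. \<Phi> t x))"

text \<open>Derivatives of functions on the half-line; at \<open>0\<close> they are one-sided.\<close>

primrec halfline_deriv :: "nat \<Rightarrow> (real \<Rightarrow> 'a::real_normed_vector) \<Rightarrow> real \<Rightarrow> 'a"
  where
    "halfline_deriv 0 f = f"
  | "halfline_deriv (Suc k) f =
      (\<lambda>t. vector_derivative (halfline_deriv k f) (at t within {0..}))"

definition C_infinity_loc :: "real set \<Rightarrow> (real \<Rightarrow> 'a::real_normed_vector) set"
  where "C_infinity_loc T =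
    (if T = {0..} then {f. \<forall>k. halfline_deriv k f differentiable_on {0..}} else UNIV)"

definition vanishing :: "real set \<Rightarrow> (real \<Rightarrow> 'a::real_normed_vector) \<Rightarrow> bool"
  where "vanishing T f \<longleftrightarrow> (f \<longlongrightarrow> 0) (inf at_top (principal T))"

definition smoothly_vanishing :: "real set \<Rightarrow> (real \<Rightarrow> 'a::real_normed_vector) \<Rightarrow> bool"
  where "smoothly_vanishing T f \<longleftrightarrow>
    (if T = {0..} then \<forall>k. vanishing T (halfline_deriv k f) else vanishing T f)"

text \<open>
  The integral over \<open>T \<inter> (0, t]\<close>. The Bochner integral of the library is restricted to
  second-countable spaces, so the Henstock--Kurzweil integral is used for \<open>T = {0..}\<close>;
  both agree on the continuous integrands occurring here. The integral against counting
  measure is a finite sum.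
\<close>

definition time_integral ::
    "real set \<Rightarrow> real \<Rightarrow> (real \<Rightarrow> 'a::real_normed_vector) \<Rightarrow> 'a"
  where "time_integral T t f =
    (if T = {0..} then integral {0<..t} f else (\<Sum>s\<in>T \<inter> {0<..t}. f s))"

definition evolution_relation ::
    "real set \<Rightarrow> (real \<Rightarrow> 'a::complex_normed_vector \<Rightarrow> 'a)
      \<Rightarrow> ((real \<Rightarrow> 'a) \<times> (real \<Rightarrow> 'a)) set"
  where "evolution_relation T \<Phi> =
    {(u, x). u \<in> C_infinity_loc T \<and> x \<in> C_infinity_loc T \<and>
      (\<forall>t\<in>T. x t = \<Phi> t (x 0) + time_integral T t (\<lambda>s. \<Phi> (t - s) (u s)))}"

definition stable_relation ::
    "real set \<Rightarrow> ((real \<Rightarrow> 'a::real_normed_vector) \<times> (real \<Rightarrow> 'a)) set \<Rightarrow> bool"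
  where "stable_relation T P \<longleftrightarrow> (\<forall>y. ((\<lambda>_. 0), y) \<in> P \<longrightarrow> vanishing T y)"

text \<open>VIVO: vanishing input implies vanishing output.\<close>

definition VIVO ::
    "real set \<Rightarrow> ((real \<Rightarrow> 'a::real_normed_vector) \<times> (real \<Rightarrow> 'a)) set \<Rightarrow> bool"
  where "VIVO T P \<longleftrightarrow> (\<forall>(u, y)\<in>P. vanishing T u \<longrightarrow> vanishing T y)"

definition smoothly_VIVO ::
    "real set \<Rightarrow> ((real \<Rightarrow> 'a::real_normed_vector) \<times> (real \<Rightarrow> 'a)) set \<Rightarrow> bool"
  where "smoothly_VIVO T P \<longleftrightarrow>
    (\<forall>(u, y)\<in>P. smoothly_vanishing T u \<longrightarrow> smoothly_vanishing T y)"

end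

theory Submission
  imports Defs
begin

text \<open>
  If the compact operator \<open>K = \<Phi> 1\<close> has no eigenvalue outside the open unit disk, then compactness
  makes \<open>1 - z K\<close> bounded below uniformly in \<open>\<bar>z\<bar> \<le> 1\<close>. Since \<open>(1 - w B) (\<Sum>i<n. w ^ i B ^ i) = 1 - w ^ n B ^ n\<close>,
  such a lower bound for \<open>B = s K\<close> controls the powers of \<open>B\<close> after averaging over roots of unity \<open>w\<close>,
  and a continuity argument in \<open>s \<in> {0..1}\<close> gives \<open>\<parallel>K ^ N\<parallel> \<le> 1 / 2\<close> for some \<open>N\<close>; neither the
  Fredholm alternative nor the spectral radius formula is needed. Trajectories satisfy
  \<open>x (t + 1) = K (x t) + g t\<close> with \<open>g\<close> vanishing whenever the input is, hence they vanish. The relation is closed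
  under differentiation, which turns this into the smooth statement.

  Conversely, an eigenvector \<open>v\<close> of \<open>K\<close> for \<open>c\<close> yields the trajectory \<open>\<Phi> t v\<close>. In continuous time it is
  smooth because the averages \<open>w \<mapsto> 1 / h \<integral>\<^sub>0\<^sup>h \<Phi> s w\<close> map the eigenspace, whose unit ball is compact, onto
  itself for small \<open>h\<close>, and averaged vectors have differentiable orbits.
\<close>

section \<open>Powers of compact operators\<close>

interpretation scaleC: bounded_bilinear "scaleC :: complex \<Rightarrow> 'a \<Rightarrow> 'a::complex_normed_vector"
proof
  fix a b :: complex and x y :: 'a and r :: real
  have of_real: "r *\<^sub>R z = complex_of_real r *\<^sub>C z" for z :: 'a
    by (simp add: scaleC_of_real)
  show "(a + b) *\<^sub>C x = a *\<^sub>C x + b *\<^sub>C x" by (rule scaleC_add_left)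
  show "a *\<^sub>C (x + y) = a *\<^sub>C x + a *\<^sub>C y" by (rule scaleC_add_right)
  show "(r *\<^sub>R a) *\<^sub>C x = r *\<^sub>R a *\<^sub>C x"
    by (simp add: of_real scaleC_scaleC scaleR_conv_of_real)
  show "a *\<^sub>C (r *\<^sub>R x) = r *\<^sub>R a *\<^sub>C x"
    by (simp add: of_real scaleC_scaleC mult.commute)
  show "\<exists>K. \<forall>a x. norm (a *\<^sub>C (x::'a)) \<le> norm a * norm x * K"
    by (rule exI[of _ 1]) (simp add: norm_scaleC)
qed

declare scaleC.zero_left [simp] scaleC.zero_right [simp]

lemma scaleC_one [simp]: "1 *\<^sub>C (x::'a::complex_normed_vector) = x"
  using scaleC_of_real[of 1 x] by simp

lemma bounded_clinear_funpow:
  assumes "bounded_clinear A"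
  shows "bounded_clinear (A ^^ n)"
proof (induction n)
  case 0
  then show ?case
    by (simp add: bounded_clinear_def id_def)
next
  case (Suc n)
  have "bounded_linear (\<lambda>x. A ((A ^^ n) x))"
    using Suc assms by (intro bounded_linear_compose[of A "A ^^ n"]) (simp_all add: bounded_clinear_def)
  then show ?case
    using Suc assms by (auto simp: bounded_clinear_def o_def)
qed

lemma bounded_linear_funpow:
  fixes A :: "'a::real_normed_vector \<Rightarrow> 'a"
  shows "bounded_linear A \<Longrightarrow> bounded_linear (A ^^ n)"
proof (induction n)
  case (Suc n)
  then show ?case
    using bounded_linear_compose[of A "A ^^ n"] by (simp add: o_def)
qed (simp add: id_def)

text \<open>Sequential compactness of the closure of the image. Compactness of
  \<open>\<Phi> 1\<close> enters the proof only through such subsequences.\<close>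

lemma compact_operator_convergent_subsequence:
  fixes y :: "nat \<Rightarrow> 'a::complex_normed_vector"
  assumes "compact_operator K" and "bounded (range y)"
  obtains l r where "strict_mono r" "(\<lambda>n. K (y (r n))) \<longlonglongrightarrow> l"
proof -
  have "compact (closure (K ` range y))"
    using assms by (auto simp: compact_operator_def)
  moreover have "\<forall>n. K (y n) \<in> closure (K ` range y)"
    by (auto intro: subsetD[OF closure_subset])
  ultimately obtain l r where "strict_mono r" "((\<lambda>n. K (y n)) \<circ> r) \<longlonglongrightarrow> l"
    unfolding compact_def by meson
  then show thesis
    using that by (simp add: o_def)
qed

text \<open>Averaging over the \<open>m\<close>-th roots of unity takes the place of Cauchy's integral formula.\<close>

lemma norm_coefficient_le:
  fixes v :: "'i \<Rightarrow> 'a::complex_normed_vector"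
  assumes fin: "finite I" and l: "l < m" and e: "\<And>i. i \<in> I \<Longrightarrow> e i < m"
    and bound: "\<And>w. w ^ m = 1 \<Longrightarrow> norm (\<Sum>i\<in>I. w ^ e i *\<^sub>C v i) \<le> D"
  shows "norm (\<Sum>i\<in>{i\<in>I. e i = l}. v i) \<le> D"
proof -
  define w where "w = exp (2 * of_real pi * \<i> / of_nat m)"
  have m: "m > 0" using l by simp
  have w_eq: "w ^ j = exp (2 * of_real pi * \<i> * of_nat j / of_nat m)" for j
    by (simp add: w_def exp_of_nat_mult[symmetric] mult_ac)
  have w_1: "w ^ j = 1 \<longleftrightarrow> m dvd j" for j
    unfolding w_eq using complex_root_unity_eq_1[of m j] m by simp
  have unimodular: "cmod (w ^ j) = 1" for j
    by (simp add: w_eq norm_exp_eq_Re)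
  \<comment> \<open>The weight \<open>(w ^ k) ^ (m - l)\<close> stands for the inverse of
    \<open>(w ^ k) ^ l\<close> while keeping exponents natural. As \<open>m - l + e i\<close> lies
    strictly between 0 and \<open>2 * m\<close>, it is a multiple of \<open>m\<close> only if it
    equals \<open>m\<close>.\<close>
  have sum_powers: "(\<Sum>k<m. (w ^ k) ^ (m - l + e i)) = (if e i = l then of_nat m else 0)"
    if "i \<in> I" for i
  proof -
    let ?q = "w ^ (m - l + e i)"
    have "(\<Sum>k<m. (w ^ k) ^ (m - l + e i)) = (\<Sum>k<m. ?q ^ k)"
      by (simp add: power_mult[symmetric] mult.commute)
    moreover have "m dvd m - l + e i \<longleftrightarrow> e i = l"
    proof
      assume "m dvd m - l + e i"
      then obtain k where k: "m - l + e i = m * k" by blast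
      have "0 < m * k" "m * k < m * 2"
        unfolding k[symmetric] using l e[OF that] by auto
      then have "0 < k" "k < 2"
        by (simp_all only: mult_less_cancel1 zero_less_mult_iff) auto
      then have "k = 1" by simp
      then show "e i = l" using k l by simp
    qed (use l in simp)
    moreover have "?q ^ m = 1"
      by (simp add: power_mult[symmetric] w_1)
    ultimately show ?thesis
      using w_1[of "m - l + e i"] by (auto simp: sum_gp_strict)
  qed
  define S where "S = (\<Sum>i\<in>{i\<in>I. e i = l}. v i)"
  have "(\<Sum>k<m. (w ^ k) ^ (m - l) *\<^sub>C (\<Sum>i\<in>I. (w ^ k) ^ e i *\<^sub>C v i))
      = (\<Sum>i\<in>I. (\<Sum>k<m. (w ^ k) ^ (m - l + e i)) *\<^sub>C v i)"
    by (simp add: scaleC.sum_right scaleC.sum_left scaleC_scaleC power_add sum.swap[of _ I])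
  also have "\<dots> = (\<Sum>i\<in>I. if e i = l then of_nat m *\<^sub>C v i else 0)"
    by (intro sum.cong refl) (simp add: sum_powers)
  also have "\<dots> = of_nat m *\<^sub>C S"
    by (simp add: S_def scaleC.sum_right sum.If_cases[OF fin] Int_def)
  finally have "of_nat m *\<^sub>C S = (\<Sum>k<m. (w ^ k) ^ (m - l) *\<^sub>C (\<Sum>i\<in>I. (w ^ k) ^ e i *\<^sub>C v i))" ..
  then have "norm (of_nat m *\<^sub>C S)
      \<le> (\<Sum>k<m. norm ((w ^ k) ^ (m - l) *\<^sub>C (\<Sum>i\<in>I. (w ^ k) ^ e i *\<^sub>C v i)))"
    by (simp only: norm_sum)
  also have "\<dots> \<le> (\<Sum>k<m. D)"
  proof (rule sum_mono)
    fix k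
    have "(w ^ k) ^ m = 1"
      by (simp add: power_mult[symmetric] w_1)
    then show "norm ((w ^ k) ^ (m - l) *\<^sub>C (\<Sum>i\<in>I. (w ^ k) ^ e i *\<^sub>C v i)) \<le> D"
      using bound[of "w ^ k"] unimodular[of "k * (m - l)"]
      by (simp add: norm_scaleC power_mult)
  qed
  finally have "m * norm S \<le> m * D"
    by (simp add: norm_scaleC)
  then show ?thesis
    using m by (simp add: S_def)
qed

text \<open>The sum telescopes under \<open>1 - w B\<close> to \<open>x - w ^ n B ^ n x\<close>, and
  the lower bound is applied to the sum itself.\<close>

lemma geometric_sum_le:
  fixes B :: "'a::complex_normed_vector \<Rightarrow> 'a"
  assumes B: "bounded_clinear B"
    and below: "\<And>x. norm x \<le> M * norm (x - w *\<^sub>C B x)"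
  shows "norm (\<Sum>i<n. w ^ i *\<^sub>C (B ^^ i) x) \<le> M * norm (x - w ^ n *\<^sub>C (B ^^ n) x)"
proof -
  interpret B: bounded_linear B
    using B by (simp add: bounded_clinear_def)
  have scaleC: "B (c *\<^sub>C x) = c *\<^sub>C B x" for c x
    using B by (simp add: bounded_clinear_def)
  define p where "p = (\<Sum>i<n. w ^ i *\<^sub>C (B ^^ i) x)"
  have "p - w *\<^sub>C B p = (\<Sum>i<n. w ^ i *\<^sub>C (B ^^ i) x - w ^ Suc i *\<^sub>C (B ^^ Suc i) x)"
    by (simp add: p_def B.sum scaleC scaleC.sum_right scaleC_scaleC sum_subtractf)
  also have "\<dots> = x - w ^ n *\<^sub>C (B ^^ n) x"
    by (subst sum_lessThan_telescope') simp
  finally show ?thesis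
    using below[of p] by (simp add: p_def)
qed

text \<open>\<open>B ^ j x\<close> is the coefficient of index \<open>j\<close> in the geometric
  sum. At the \<open>n\<close>-th roots of unity \<open>w ^ n = 1\<close>, so the bound from
  \<open>geometric_sum_le\<close> no longer depends on \<open>w\<close> and averaging
  applies.\<close>

lemma power_le_of_bounded_below:
  fixes B :: "'a::complex_normed_vector \<Rightarrow> 'a"
  assumes B: "bounded_clinear B"
    and below: "\<And>z x. cmod z = 1 \<Longrightarrow> norm x \<le> M * norm (x - z *\<^sub>C B x)"
    and "j < n"
  shows "norm ((B ^^ j) x) \<le> M * norm (x - (B ^^ n) x)"
proof -
  have "norm (\<Sum>i\<in>{i\<in>{..<n}. i = j}. (B ^^ i) x) \<le> M * norm (x - (B ^^ n) x)"
  proof (rule norm_coefficient_le)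
    fix w :: complex
    assume w: "w ^ n = 1"
    then have "cmod w = 1"
      using power_eq_1_iff[OF w] \<open>j < n\<close> by auto
    then show "norm (\<Sum>i<n. w ^ i *\<^sub>C (B ^^ i) x) \<le> M * norm (x - (B ^^ n) x)"
      using geometric_sum_le[OF B below[OF \<open>cmod w = 1\<close>], where n = n and x = x] w by simp
  qed (use \<open>j < n\<close> in auto)
  moreover have "{i\<in>{..<n}. i = j} = {j}"
    using \<open>j < n\<close> by auto
  ultimately show ?thesis by simp
qed

text \<open>The coefficient of index \<open>n - 1\<close> of the square of \<open>\<Sum>i<n. w ^ i B ^ i\<close> is \<open>n B ^ (n - 1)\<close>,
  while the square itself is bounded uniformly in \<open>n\<close>.\<close>

lemma power_decay_of_power_bounded:
  fixes B :: "'a::complex_normed_vector \<Rightarrow> 'a"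
  assumes B: "bounded_clinear B"
    and M: "0 \<le> M"
    and below: "\<And>z x. cmod z = 1 \<Longrightarrow> norm x \<le> M * norm (x - z *\<^sub>C B x)"
    and bounded: "\<And>n x. norm ((B ^^ n) x) \<le> C * norm x"
  shows "real (Suc n) * norm ((B ^^ n) x) \<le> (M * (1 + C))\<^sup>2 * norm x"
proof -
  define p where "p w y = (\<Sum>i<Suc n. w ^ i *\<^sub>C (B ^^ i) y)" for w y
  have p_le: "norm (p w y) \<le> M * (1 + C) * norm y" if w: "cmod w = 1" for w y
  proof -
    have "norm (p w y) \<le> M * norm (y - w ^ Suc n *\<^sub>C (B ^^ Suc n) y)"
      unfolding p_def by (rule geometric_sum_le[OF B below[OF w]])
    also have "norm (y - w ^ Suc n *\<^sub>C (B ^^ Suc n) y) \<le> norm y + norm ((B ^^ Suc n) y)"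
      using norm_triangle_ineq4[of y "w ^ Suc n *\<^sub>C (B ^^ Suc n) y"] w
      by (simp add: norm_scaleC norm_power norm_mult)
    also have "\<dots> \<le> (1 + C) * norm y"
      using bounded[of "Suc n" y] by (simp add: algebra_simps)
    finally show ?thesis
      using M by (simp add: mult_left_mono mult.assoc)
  qed
  \<comment> \<open>The sign of this factor comes from \<open>p_le\<close> at a nonzero vector;
    \<open>x = 0\<close> is treated separately below.\<close>
  have C: "0 \<le> M * (1 + C)" if "x \<noteq> 0"
    using p_le[of 1 x] that by (smt (verit) norm_ge_zero norm_one zero_le_mult_iff zero_less_norm_iff)
  let ?I = "{..<Suc n} \<times> {..<Suc n}"
  have "norm (\<Sum>i\<in>{i\<in>?I. fst i + snd i = n}. (B ^^ (fst i + snd i)) x) \<le> (M * (1 + C))\<^sup>2 * norm x"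
  proof (rule norm_coefficient_le)
    \<comment> \<open>With \<open>2 * Suc n\<close> roots of unity all exponents
      \<open>i + j \<le> 2 * n\<close> stay below the modulus, so averaging isolates
      \<open>i + j = n\<close>.\<close>
    show "n < 2 * Suc n" by simp
    fix w :: complex
    assume w1: "w ^ (2 * Suc n) = 1"
    have w: "cmod w = 1"
      using power_eq_1_iff[OF w1] by auto
    have lin: "(B ^^ i) (\<Sum>j<Suc n. w ^ j *\<^sub>C (B ^^ j) x) = (\<Sum>j<Suc n. w ^ j *\<^sub>C (B ^^ i) ((B ^^ j) x))" for i
      using bounded_clinear_funpow[OF B, of i]
      by (simp only: bounded_clinear_def linear_sum[OF bounded_linear.linear] simp_thms)
    have "(\<Sum>i\<in>?I. w ^ (fst i + snd i) *\<^sub>C (B ^^ (fst i + snd i)) x)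
        = (\<Sum>i<Suc n. \<Sum>j<Suc n. w ^ (i + j) *\<^sub>C (B ^^ (i + j)) x)"
      by (simp only: sum.cartesian_product) (simp add: case_prod_unfold)
    also have "\<dots> = p w (p w x)"
      unfolding p_def lin by (simp only: scaleC.sum_right scaleC_scaleC power_add funpow_add o_def)
    finally have eq: "(\<Sum>i\<in>?I. w ^ (fst i + snd i) *\<^sub>C (B ^^ (fst i + snd i)) x) = p w (p w x)" .
    have "norm (p w (p w x)) \<le> (M * (1 + C))\<^sup>2 * norm x"
    proof (cases "x = 0")
      case True
      then show ?thesis using p_le[OF w, of 0] p_le[OF w, of "p w 0"] by auto
    next
      case False
      then show ?thesis
        using p_le[OF w, of "p w x"] mult_left_mono[OF p_le[OF w, of x] C]
        by (simp add: power2_eq_square mult.assoc)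
    qed
    then show "norm (\<Sum>i\<in>?I. w ^ (fst i + snd i) *\<^sub>C (B ^^ (fst i + snd i)) x) \<le> (M * (1 + C))\<^sup>2 * norm x"
      unfolding eq .
  qed auto
  moreover have "{i\<in>?I. fst i + snd i = n} = (\<lambda>k. (k, n - k)) ` {..<Suc n}"
    by force
  then have "card {i\<in>?I. fst i + snd i = n} = Suc n"
    by (simp add: card_image inj_on_def)
  then have "(\<Sum>i\<in>{i\<in>?I. fst i + snd i = n}. (B ^^ (fst i + snd i)) x) = real (Suc n) *\<^sub>R (B ^^ n) x"
    by (simp add: sum_constant_scaleR)
  ultimately show ?thesis by simp
qed

lemma funpow_scaleR:
  fixes K :: "'a::real_normed_vector \<Rightarrow> 'a"
  shows "bounded_linear K \<Longrightarrow> ((\<lambda>x. s *\<^sub>R K x) ^^ n) x = s ^ n *\<^sub>R (K ^^ n) x"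
  by (induction n) (simp_all add: linear_cmul[OF bounded_linear.linear])

text \<open>Splitting off a block of \<open>N\<close> factors costs nothing in the bound, so only
  the powers below \<open>N\<close> matter; their operator norms are added up.\<close>

lemma power_bounded_if_power_contractive:
  fixes A :: "'a::real_normed_vector \<Rightarrow> 'a"
  assumes A: "bounded_linear A" and N: "0 < N" and contr: "\<And>x. norm ((A ^^ N) x) \<le> norm x"
  obtains C where "\<And>n x. norm ((A ^^ n) x) \<le> C * norm x"
proof -
  define C where "C = (\<Sum>r<N. onorm (A ^^ r))"
  have nonneg: "0 \<le> onorm (A ^^ r)" for r
    by (simp add: A bounded_linear_funpow onorm_pos_le)
  have "norm ((A ^^ n) x) \<le> C * norm x" for n x
  proof (induction n arbitrary: x rule: less_induct)
    case (less n)
    show ?case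
    proof (cases "n < N")
      case True
      have "norm ((A ^^ n) x) \<le> onorm (A ^^ n) * norm x"
        by (simp add: A bounded_linear_funpow onorm)
      also have "onorm (A ^^ n) \<le> C"
        unfolding C_def using True nonneg by (intro member_le_sum) auto
      finally show ?thesis by (simp add: mult_right_mono)
    next
      case False
      have "(A ^^ n) x = (A ^^ (n - N)) ((A ^^ N) x)"
        using False funpow_add[of "n - N" N A] by simp
      also have "norm \<dots> \<le> C * norm ((A ^^ N) x)"
        using False N by (intro less) simp
      also have "\<dots> \<le> C * norm x"
        by (intro mult_left_mono contr) (simp add: C_def sum_nonneg nonneg)
      finally show ?thesis .
    qed
  qed
  then show thesis by (rule that)
qed

text \<open>The set of scales \<open>s \<in> {0..1}\<close> for which \<open>s K\<close> is power bounded contains \<open>0\<close>, is closed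
  since the bound is then uniform, and is relatively open since the powers then even decay.\<close>

lemma contractive_power_of_bounded_below:
  fixes K :: "'a::complex_normed_vector \<Rightarrow> 'a"
  assumes K: "bounded_clinear K"
    and M: "0 \<le> M"
    and below: "\<And>z x. cmod z \<le> 1 \<Longrightarrow> norm x \<le> M * norm (x - z *\<^sub>C K x)"
  shows "\<exists>N>0. \<forall>x. norm ((K ^^ N) x) \<le> norm x / 2"
proof -
  have lin: "bounded_linear K"
    using K by (simp add: bounded_clinear_def)
  have B: "bounded_clinear (\<lambda>x. s *\<^sub>R K x)" for s
    using K by (auto simp: bounded_clinear_def bounded_linear_const_scaleR scaleC.scaleR_right)
  have below_s: "norm x \<le> M * norm (x - z *\<^sub>C (s *\<^sub>R K x))" if "0 \<le> s" "s \<le> 1" "cmod z = 1" for s z x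
    using below[of "s *\<^sub>R z" x] that by (simp add: scaleC.scaleR_left scaleC.scaleR_right)
  \<comment> \<open>For a scale with bounded powers the \<open>n\<close>-th power has norm at most
    \<open>D / (n + 1)\<close>, so any \<open>n > 2 * D\<close> serves as \<open>N\<close>.\<close>
  have decay: "\<exists>N>0. \<forall>x. s ^ N * norm ((K ^^ N) x) \<le> norm x / 2"
    if s: "0 \<le> s" "s \<le> 1" and C: "\<And>n x. s ^ n * norm ((K ^^ n) x) \<le> C * norm x" for s C
  proof -
    define D where "D = (M * (1 + C))\<^sup>2"
    obtain n where n: "2 * D < real n"
      using reals_Archimedean2 by blast
    have "s ^ n * norm ((K ^^ n) x) \<le> norm x / 2" for x
    proof -
      have "real (Suc n) * (s ^ n * norm ((K ^^ n) x)) \<le> D * norm x"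
        using power_decay_of_power_bounded[OF B M below_s[OF s], of C n x] C s
        by (simp add: funpow_scaleR[OF lin] D_def)
      also have "\<dots> \<le> real (Suc n) / 2 * norm x"
        using n by (intro mult_right_mono) auto
      finally have "real (Suc n) * (s ^ n * norm ((K ^^ n) x)) \<le> real (Suc n) * (norm x / 2)"
        by simp
      then show ?thesis
        by (rule mult_left_le_imp_le) simp
    qed
    moreover have "0 < n"
      using n by (cases n) (auto simp: D_def not_less)
    ultimately show ?thesis by blast
  qed
  define S where "S = {s\<in>{0..1}. \<forall>n x. s ^ n * norm ((K ^^ n) x) \<le> M * norm x}"
  \<comment> \<open>Any power bound \<open>C\<close> improves to the fixed bound \<open>M\<close>:
    \<open>power_le_of_bounded_below\<close> holds for all \<open>n > j\<close>, and its right side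
    tends to \<open>M * norm x\<close> because the powers tend to 0.\<close>
  have in_S: "s \<in> S" if s: "0 \<le> s" "s \<le> 1" and C: "\<And>n x. s ^ n * norm ((K ^^ n) x) \<le> C * norm x" for s C
  proof -
    define D where "D = (M * (1 + C))\<^sup>2"
    have "s ^ j * norm ((K ^^ j) x) \<le> M * norm x" for j x
    proof (rule tendsto_lowerbound)
      have lim0: "(\<lambda>n. s ^ n *\<^sub>R (K ^^ n) x) \<longlonglongrightarrow> 0"
      proof (rule Lim_null_comparison)
        show "\<forall>\<^sub>F n in sequentially. norm (s ^ n *\<^sub>R (K ^^ n) x) \<le> D * norm x * inverse (real (Suc n))"
        proof (intro always_eventually allI)
          fix n
          have "real (Suc n) * (s ^ n * norm ((K ^^ n) x)) \<le> D * norm x"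
            using power_decay_of_power_bounded[OF B M below_s[OF s], of C n x] C s
            by (simp add: funpow_scaleR[OF lin] D_def)
          then show "norm (s ^ n *\<^sub>R (K ^^ n) x) \<le> D * norm x * inverse (real (Suc n))"
            using s by (simp add: field_simps)
        qed
        show "(\<lambda>n. D * norm x * inverse (real (Suc n))) \<longlonglongrightarrow> 0"
          by (intro tendsto_mult_right_zero LIMSEQ_inverse_real_of_nat)
      qed
      show "(\<lambda>n. M * norm (x - s ^ n *\<^sub>R (K ^^ n) x)) \<longlonglongrightarrow> M * norm x"
        using tendsto_mult_left[OF tendsto_norm[OF tendsto_diff[OF tendsto_const lim0]]] by simp
      show "\<forall>\<^sub>F n in sequentially. s ^ j * norm ((K ^^ j) x) \<le> M * norm (x - s ^ n *\<^sub>R (K ^^ n) x)"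
        using eventually_gt_at_top[of j]
      proof eventually_elim
        case (elim n)
        show ?case
          using power_le_of_bounded_below[OF B below_s[OF s], of j n x] s elim
          by (simp add: funpow_scaleR[OF lin])
      qed
    qed simp
    then show ?thesis
      using s by (simp add: S_def)
  qed
  have "S = {0..1} \<inter> {s. \<forall>n x. s ^ n * norm ((K ^^ n) x) \<le> M * norm x}"
    by (auto simp: S_def)
  then have "closed S"
    by (simp only:) (intro closed_Int closed_atLeastAtMost closed_Collect_all closed_Collect_le continuous_intros)
  moreover have "0 \<in> S"
  proof (rule in_S)
    show "0 ^ n * norm ((K ^^ n) x) \<le> 1 * norm x" for n x
      by (cases n) auto
  qed auto
  moreover have "bdd_above S"
    by (auto simp: S_def bdd_above_def)
  ultimately have Sup_S: "Sup S \<in> S"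
    by (intro closed_contains_Sup) auto
  define s where "s = Sup S"
  have s: "0 \<le> s" "s \<le> 1" and s_bound: "\<And>n x. s ^ n * norm ((K ^^ n) x) \<le> M * norm x"
    using Sup_S by (auto simp: S_def s_def)
  obtain N where N: "0 < N" and half: "\<And>x. s ^ N * norm ((K ^^ N) x) \<le> norm x / 2"
    using decay[OF s s_bound] by blast
  \<comment> \<open>Otherwise \<open>s ^ N * onorm (K ^^ N) < 1\<close> persists for some
    \<open>r > s\<close>. Then the powers of \<open>r K\<close> are bounded and
    \<open>r \<in> S\<close>, against the choice of \<open>s\<close>.\<close>
  have "s = 1"
  proof (rule ccontr)
    assume "s \<noteq> 1"
    then have "s < 1" using s by simp
    have linN: "bounded_linear (K ^^ N)"
      by (rule bounded_linear_funpow[OF lin])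
    have "onorm (\<lambda>x. s ^ N *\<^sub>R (K ^^ N) x) \<le> 1 / 2"
      using half s by (intro onorm_bound) simp_all
    then have "s ^ N * onorm (K ^^ N) < 1"
      using s by (simp add: onorm_scaleR[OF linN])
    moreover have "((\<lambda>r. r ^ N * onorm (K ^^ N)) \<longlongrightarrow> s ^ N * onorm (K ^^ N)) (at_right s)"
      by (intro tendsto_intros)
    ultimately have "\<forall>\<^sub>F r in at_right s. r ^ N * onorm (K ^^ N) < 1"
      by (rule order_tendstoD(2)[rotated])
    moreover have "\<forall>\<^sub>F r in at_right s. s < r \<and> r < 1"
      using \<open>s < 1\<close> by (intro eventually_conj eventually_at_right_less) (auto simp: eventually_at_right)
    ultimately have "\<forall>\<^sub>F r in at_right s. r ^ N * onorm (K ^^ N) < 1 \<and> s < r \<and> r < 1"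
      by (rule eventually_conj)
    then obtain r where r: "r ^ N * onorm (K ^^ N) < 1" "s < r" "r < 1"
      using eventually_happens'[OF trivial_limit_at_right_real] by blast
    have "norm (((\<lambda>x. r *\<^sub>R K x) ^^ N) x) \<le> norm x" for x
    proof -
      have "r ^ N * norm ((K ^^ N) x) \<le> r ^ N * (onorm (K ^^ N) * norm x)"
        using r s by (intro mult_left_mono onorm[OF linN]) simp
      also have "\<dots> \<le> 1 * norm x"
        unfolding mult.assoc[symmetric] using r by (intro mult_right_mono) auto
      finally show ?thesis
        using r s by (simp add: funpow_scaleR[OF lin])
    qed
    then obtain C where "\<And>n x. norm (((\<lambda>x. r *\<^sub>R K x) ^^ n) x) \<le> C * norm x"
      using power_bounded_if_power_contractive[of "\<lambda>x. r *\<^sub>R K x" N]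
        N bounded_linear_const_scaleR[OF lin] by blast
    then have "r \<in> S"
      using r s by (intro in_S) (auto simp: funpow_scaleR[OF lin])
    then have "r \<le> s"
      unfolding s_def using \<open>bdd_above S\<close> by (rule cSup_upper)
    then show False using r by simp
  qed
  then show ?thesis
    using N half by auto
qed

text \<open>Otherwise there are unit vectors \<open>y n\<close> and scalars \<open>z n\<close> in
  the closed disk with \<open>y n - z n K (y n)\<close> tending to 0. Compactness of the disk and of
  \<open>K\<close> yields a limit \<open>c l\<close> of norm 1, an eigenvector for
  \<open>inverse c\<close>.\<close>

lemma bounded_below_if_no_eigenvalue:
  fixes K :: "'a::complex_normed_vector \<Rightarrow> 'a"
  assumes K: "compact_operator K"
    and no_eigenvalue: "\<And>c. 1 \<le> cmod c \<Longrightarrow> \<not> eigenvalue_of K c"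
  obtains M where "0 \<le> M" "\<And>z x. cmod z \<le> 1 \<Longrightarrow> norm x \<le> M * norm (x - z *\<^sub>C K x)"
proof (rule ccontr)
  interpret K: bounded_linear K
    using K by (simp add: compact_operator_def bounded_clinear_def)
  assume "\<not> thesis"
  \<comment> \<open>Each candidate \<open>M = real n\<close> fails.\<close>
  then have "\<forall>n. \<exists>z x. cmod z \<le> 1 \<and> real n * norm (x - z *\<^sub>C K x) < norm x"
    using that by (metis not_le of_nat_0_le_iff)
  then obtain z x where z: "\<And>n. cmod (z n) \<le> 1"
    and x: "\<And>n. real n * norm (x n - z n *\<^sub>C K (x n)) < norm (x n)"
    by metis
  define y where "y n = x n /\<^sub>R norm (x n)" for n
  have x_nz: "norm (x n) > 0" for n
    using x[of n] by (smt (verit) mult_nonneg_nonneg norm_ge_zero of_nat_0_le_iff)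
  have norm_y: "norm (y n) = 1" for n
    using x_nz[of n] by (simp add: y_def)
  have "y n - z n *\<^sub>C K (y n) = (x n - z n *\<^sub>C K (x n)) /\<^sub>R norm (x n)" for n
    by (simp add: y_def K.scaleR scaleC.scaleR_right scaleR_diff_right)
  then have "norm (y n - z n *\<^sub>C K (y n)) = norm (x n - z n *\<^sub>C K (x n)) / norm (x n)" for n
    by (simp add: divide_inverse mult.commute)
  then have "real n * norm (y n - z n *\<^sub>C K (y n)) \<le> 1" for n
    using x[of n] x_nz[of n] by simp
  then have le: "norm (y n - z n *\<^sub>C K (y n)) \<le> inverse (real n)" if "0 < n" for n
    using that by (simp add: field_simps)
  have lim0: "(\<lambda>n. y n - z n *\<^sub>C K (y n)) \<longlonglongrightarrow> 0"
    by (rule Lim_null_comparison[OF _ lim_inverse_n])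
      (rule eventually_mono[OF eventually_gt_at_top[of 0]], rule le)
  have "compact (cball 0 1 :: complex set)" by simp
  moreover have "\<forall>n. z n \<in> cball 0 1" using z by simp
  ultimately obtain r c where r: "strict_mono r" and c: "(z \<circ> r) \<longlonglongrightarrow> c" and "c \<in> cball 0 1"
    unfolding compact_def by metis
  have "bounded (range (\<lambda>n. y (r n)))"
    by (rule boundedI[of _ 1]) (auto simp: norm_y)
  then obtain q l where q: "strict_mono q" and l: "(\<lambda>n. K (y (r (q n)))) \<longlonglongrightarrow> l"
    using compact_operator_convergent_subsequence[OF K, of "\<lambda>n. y (r n)"] by blast
  have rq: "strict_mono (r \<circ> q)"
    using r q by (rule strict_mono_o)
  have "(\<lambda>n. z (r (q n)) *\<^sub>C K (y (r (q n)))) \<longlonglongrightarrow> c *\<^sub>C l"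
    using LIMSEQ_subseq_LIMSEQ[OF c q] l by (intro scaleC.tendsto) (auto simp: o_def)
  from tendsto_add[OF LIMSEQ_subseq_LIMSEQ[OF lim0 rq] this[folded o_def]]
  have y_lim: "(\<lambda>n. y (r (q n))) \<longlonglongrightarrow> c *\<^sub>C l"
    by (simp add: o_def)
  then have "(\<lambda>n. norm (y (r (q n)))) \<longlonglongrightarrow> norm (c *\<^sub>C l)"
    by (rule tendsto_norm)
  then have norm1: "norm (c *\<^sub>C l) = 1"
    by (simp add: norm_y LIMSEQ_const_iff)
  \<comment> \<open>The images of the subsequence tend to \<open>K (c l)\<close> by continuity and
    to \<open>l\<close> by its choice.\<close>
  have Kl: "K (c *\<^sub>C l) = l"
    using K.tendsto[OF y_lim] l by (rule LIMSEQ_unique)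
  have "c \<noteq> 0" using norm1 by auto
  then have "K (c *\<^sub>C l) = inverse c *\<^sub>C (c *\<^sub>C l)"
    by (simp add: Kl scaleC_scaleC)
  then have "eigenvalue_of K (inverse c)"
    unfolding eigenvalue_of_def using norm1 by (intro exI[of _ "c *\<^sub>C l"]) auto
  moreover have "1 \<le> cmod (inverse c)"
    using \<open>c \<in> cball 0 1\<close> \<open>c \<noteq> 0\<close> by (simp add: norm_inverse one_le_inverse)
  ultimately show False
    using no_eigenvalue by blast
qed

lemma compact_operator_contractive_power:
  fixes K :: "'a::complex_normed_vector \<Rightarrow> 'a"
  assumes K: "compact_operator K"
    and no_eigenvalue: "\<And>c. 1 \<le> cmod c \<Longrightarrow> \<not> eigenvalue_of K c"
  shows "\<exists>N>0. \<forall>x. norm ((K ^^ N) x) \<le> norm x / 2"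
proof -
  obtain M where "0 \<le> M" "\<And>z x. cmod z \<le> 1 \<Longrightarrow> norm x \<le> M * norm (x - z *\<^sub>C K x)"
    using bounded_below_if_no_eigenvalue[OF assms] by blast
  then show ?thesis
    using K by (intro contractive_power_of_bounded_below) (auto simp: compact_operator_def)
qed

section \<open>Uniform boundedness\<close>

text \<open>Banach-Steinhaus by Baire category: the closed sets \<open>S n\<close> cover the space,
  so one of them contains a ball of some radius \<open>r\<close>. A vector of length
  \<open>r\<close> is a difference of two of its points, whence the bound \<open>2 * n\<close> on
  such vectors.\<close>

lemma uniform_boundedness:
  fixes A :: "'i \<Rightarrow> 'a::banach \<Rightarrow> 'b::real_normed_vector"
  assumes lin: "\<And>i. i \<in> I \<Longrightarrow> bounded_linear (A i)"
    and pointwise: "\<And>x. \<exists>C. \<forall>i\<in>I. norm (A i x) \<le> C"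
  obtains C where "0 \<le> C" "\<And>i x. i \<in> I \<Longrightarrow> norm (A i x) \<le> C * norm x"
proof -
  define S where "S n = {x. \<forall>i\<in>I. norm (A i x) \<le> real n}" for n
  have closed_S: "closed (S n)" for n
  proof -
    have "S n = (\<Inter>i\<in>I. {x. norm (A i x) \<le> real n})"
      by (auto simp: S_def)
    then show ?thesis
      using lin by (simp only:)
        (intro closed_INT ballI closed_Collect_le continuous_on_norm continuous_on_const
          linear_continuous_on)
  qed
  have "\<exists>n. x \<in> S n" for x
  proof -
    obtain C where "\<forall>i\<in>I. norm (A i x) \<le> C"
      using pointwise by blast
    moreover obtain n where "C \<le> real n"
      using real_arch_simple by blast
    ultimately have "x \<in> S n"
      by (force simp: S_def)
    then show ?thesis ..
  qed
  then have "\<Union> (range S) = UNIV" by auto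
  have "\<exists>n. interior (S n) \<noteq> {}"
  proof (rule ccontr)
    assume "\<not> ?thesis"
    then have "euclidean interior_of \<Union> (range S) = {}"
      using closed_S completely_metrizable_space_euclidean
      by (intro Baire_category_alt) auto
    then show False
      using \<open>\<Union> (range S) = UNIV\<close> by simp
  qed
  then obtain n x0 where "x0 \<in> interior (S n)" by blast
  then obtain r where r: "0 < r" "cball x0 r \<subseteq> S n"
    using mem_interior_cball by blast
  show thesis
  proof (rule that[of "2 * real n / r"])
    show "0 \<le> 2 * real n / r" using r by simp
    fix i x assume i: "i \<in> I"
    interpret A: bounded_linear "A i" using i by (rule lin)
    show "norm (A i x) \<le> 2 * real n / r * norm x"
    proof (cases "x = 0")
      case True
      then show ?thesis by (simp add: A.zero)
    next
      case False
      define y where "y = (r / norm x) *\<^sub>R x"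
      have "norm y = r" using False r by (simp add: y_def)
      then have "x0 + y \<in> S n" "x0 \<in> S n"
        using r by (auto simp: dist_norm intro!: subsetD[OF r(2)])
      then have "norm (A i (x0 + y)) \<le> n" "norm (A i x0) \<le> n"
        using i by (auto simp: S_def)
      moreover have "A i y = A i (x0 + y) - A i x0"
        by (simp add: A.add)
      ultimately have "norm (A i y) \<le> 2 * n"
        using norm_triangle_ineq4[of "A i (x0 + y)" "A i x0"] by simp
      then show ?thesis
        using False r by (simp add: y_def A.scaleR field_simps)
    qed
  qed
qed

section \<open>Smooth and vanishing functions on the time domain\<close>

text \<open>Every point of the half-line, including 0, is a limit point of it; this makes one-sided
  derivatives unique.\<close>

lemma at_halfline_neq_bot: "0 \<le> t \<Longrightarrow> at t within {0..} \<noteq> (bot :: real filter)"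
  using islimpt_subset[of t "{t..t + 1}" "{0..}"]
  by (auto simp: trivial_limit_within islimpt_Icc)

text \<open>Iterated derivatives are read off from an explicit tower \<open>g\<close>. Agreement on
  the half-line suffices, since derivatives within it see no negative times.\<close>

lemma halfline_deriv_eqI:
  assumes deriv: "\<And>k t. 0 \<le> t \<Longrightarrow> (g k has_vector_derivative g (Suc k) t) (at t within {0..})"
    and eq: "\<And>t. 0 \<le> t \<Longrightarrow> f t = g 0 t" and "0 \<le> t"
  shows "halfline_deriv k f t = g k t"
  using \<open>0 \<le> t\<close>
proof (induction k arbitrary: t)
  case (Suc k)
  then have "(halfline_deriv k f has_vector_derivative g (Suc k) t) (at t within {0..})"
    by (intro has_vector_derivative_transform[OF _ _ deriv]) auto
  then show ?case
    using at_halfline_neq_bot[OF Suc.prems] by (simp add: vector_derivative_within)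
qed (simp add: eq)

lemma C_infinity_locI:
  assumes deriv: "\<And>k t. 0 \<le> t \<Longrightarrow> (g k has_vector_derivative g (Suc k) t) (at t within {0..})"
    and eq: "\<And>t. 0 \<le> t \<Longrightarrow> f t = g 0 t"
  shows "f \<in> C_infinity_loc {0..}"
proof -
  have "(halfline_deriv k f has_vector_derivative g (Suc k) t) (at t within {0..})" if "0 \<le> t" for k t
    using that halfline_deriv_eqI[OF assms]
    by (intro has_vector_derivative_transform[OF _ _ deriv]) auto
  then show ?thesis
    by (auto simp: C_infinity_loc_def differentiable_on_def intro: differentiableI_vector)
qed

lemma halfline_deriv_has_vector_derivative:
  assumes "f \<in> C_infinity_loc {0..}" and "0 \<le> t"
  shows "(halfline_deriv k f has_vector_derivative halfline_deriv (Suc k) f t) (at t within {0..})"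
  using assms by (simp add: C_infinity_loc_def differentiable_on_def vector_derivative_works[symmetric])

lemma C_infinity_loc_continuous_on:
  "f \<in> C_infinity_loc {0..} \<Longrightarrow> continuous_on {0..} (halfline_deriv k f)"
  by (simp add: C_infinity_loc_def differentiable_imp_continuous_on)

text \<open>The recursion adds derivatives on the outside; moving one inside shows that smoothness
  is inherited by the derivative.\<close>

lemma halfline_deriv_Suc_shift:
  "halfline_deriv k (halfline_deriv (Suc 0) f) = halfline_deriv (Suc k) f"
  by (induction k) auto

lemma halfline_deriv_Suc_left: "halfline_deriv (Suc k) f = halfline_deriv (Suc 0) (halfline_deriv k f)"
  by simp

declare halfline_deriv.simps(2) [simp del]

lemma C_infinity_loc_deriv:
  "f \<in> C_infinity_loc {0..} \<Longrightarrow> halfline_deriv (Suc 0) f \<in> C_infinity_loc {0..}"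
  by (simp add: C_infinity_loc_def halfline_deriv_Suc_shift)

text \<open>Uniform continuity of the derivative on \<open>{0..a + 1}\<close>, where the extra unit
  leaves room for \<open>t + h\<close>, combined with the mean value estimate. The uniformity in
  \<open>t\<close> lets limits pass under the convolution integral.\<close>

lemma difference_quotient_uniform:
  fixes f :: "real \<Rightarrow> 'a::real_normed_vector"
  assumes f: "f \<in> C_infinity_loc {0..}" and e: "0 < e"
  obtains \<delta> where "0 < \<delta>"
    "\<And>h t. 0 < h \<Longrightarrow> h < \<delta> \<Longrightarrow> t \<in> {0..a} \<Longrightarrow>
       norm ((f (t + h) - f t) /\<^sub>R h - halfline_deriv (Suc 0) f t) \<le> e"
proof -
  let ?f' = "halfline_deriv (Suc 0) f"
  have "uniformly_continuous_on {0..a + 1} ?f'"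
    by (intro compact_uniformly_continuous continuous_on_subset[OF C_infinity_loc_continuous_on[OF f]]) auto
  then obtain d where d: "0 < d"
    and unif: "\<And>s t. s \<in> {0..a + 1} \<Longrightarrow> t \<in> {0..a + 1} \<Longrightarrow> dist s t < d \<Longrightarrow> dist (?f' s) (?f' t) < e"
    using e unfolding uniformly_continuous_on_def by metis
  show thesis
  proof (rule that[of "min d 1"])
    show "0 < min d 1" using d by simp
    fix h t :: real assume h: "0 < h" "h < min d 1" and t: "t \<in> {0..a}"
    have "norm (f (t + h) - f t - (t + h - t) *\<^sub>R ?f' t) \<le> norm (t + h - t) * e"
    proof (rule vector_differentiable_bound_linearization[where S = "{t..t + h}"])
      fix s assume s: "s \<in> {t..t + h}"
      show "(f has_vector_derivative ?f' s) (at s within {t..t + h})"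
        using halfline_deriv_has_vector_derivative[OF f, of s 0] s t
        by (intro has_vector_derivative_within_subset[where S = "{0..}" and T = "{t..t + h}"])
          (simp_all add: subset_eq)
      show "norm (?f' s - ?f' t) \<le> e"
        using unif[of s t] s t h by (simp add: dist_norm)
    qed (use h in \<open>auto simp: closed_segment_eq_real_ivl\<close>)
    then have "norm ((f (t + h) - f t) - h *\<^sub>R ?f' t) \<le> h * e"
      using h by simp
    moreover have "(f (t + h) - f t) /\<^sub>R h - ?f' t = ((f (t + h) - f t) - h *\<^sub>R ?f' t) /\<^sub>R h"
      using h by (simp add: scaleR_diff_right)
    ultimately show "norm ((f (t + h) - f t) /\<^sub>R h - ?f' t) \<le> e"
      using h by (simp only: norm_scaleR) (simp add: inverse_eq_divide pos_divide_le_eq mult.commute)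
  qed
qed

section \<open>Vanishing functions and contractive recursions\<close>

lemma vanishing_iff:
  "vanishing T f \<longleftrightarrow> (\<forall>e>0. \<exists>a. \<forall>t\<in>T. a \<le> t \<longrightarrow> norm (f t) < e)"
  unfolding vanishing_def tendsto_iff eventually_inf_principal eventually_at_top_linorder
  by (simp add: dist_norm Ball_def) meson

text \<open>Iterating the recursion \<open>N\<close> times leaves a vanishing defect, so eventually
  \<open>norm (x t)\<close> is at most half of \<open>norm (x (t - N))\<close> plus
  \<open>e / 4\<close>. The bounds on initial segments give this decay a uniform start.\<close>

lemma vanishing_recursion:
  fixes x g :: "real \<Rightarrow> 'a::real_normed_vector"
  assumes time: "T = {0..} \<or> T = \<nat>"
    and K: "bounded_linear K" and N: "0 < N" and contr: "\<And>v. norm ((K ^^ N) v) \<le> norm v / 2"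
    and rec: "\<And>t. t \<in> T \<Longrightarrow> x (t + 1) = K (x t) + g t"
    and g: "vanishing T g"
    and bounded: "\<And>a. \<exists>B. \<forall>t\<in>T. t \<le> a \<longrightarrow> norm (x t) \<le> B"
  shows "vanishing T x"
proof -
  have T_add: "t + real n \<in> T" if "t \<in> T" for t n
    using time that by auto
  have T_diff: "t - real n \<in> T" if "t \<in> T" "real n \<le> t" for t n
    using time that by (auto elim!: Nats_cases simp: of_nat_diff[symmetric] simp del: of_nat_diff)
  interpret K: bounded_linear K by (rule K)
  have iterate: "vanishing T (\<lambda>t. x (t + real n) - (K ^^ n) (x t))" for n
  proof (induction n)
    case 0
    then show ?case by (simp add: vanishing_def)
  next
    case (Suc n)
    obtain C where C: "0 < C" "\<And>v. norm (K v) \<le> norm v * C"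
      using K.pos_bounded by blast
    show ?case
      unfolding vanishing_iff
    proof (intro allI impI)
      fix e :: real assume e: "0 < e"
      obtain a where a: "\<And>t. t \<in> T \<Longrightarrow> a \<le> t \<Longrightarrow> norm (x (t + real n) - (K ^^ n) (x t)) < e / (2 * C)"
        using Suc.IH e C unfolding vanishing_iff by (meson divide_pos_pos mult_pos_pos zero_less_numeral)
      obtain b where b: "\<And>t. t \<in> T \<Longrightarrow> b \<le> t \<Longrightarrow> norm (g t) < e / 2"
        using g e unfolding vanishing_iff by (meson half_gt_zero)
      have "norm (x (t + real (Suc n)) - (K ^^ Suc n) (x t)) < e" if t: "t \<in> T" "max a b \<le> t" for t
      proof -
        have "x (t + real (Suc n)) - (K ^^ Suc n) (x t) = K (x (t + real n) - (K ^^ n) (x t)) + g (t + real n)"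
          using rec[OF T_add[OF t(1), of n]] by (simp add: K.diff add_ac)
        moreover have "norm (K (x (t + real n) - (K ^^ n) (x t))) < e / 2"
          using C(2)[of "x (t + real n) - (K ^^ n) (x t)"] a[of t] t C(1) by (simp add: field_simps)
        moreover have "norm (g (t + real n)) < e / 2"
          using t T_add by (intro b) auto
        ultimately show ?thesis
          using norm_triangle_ineq[of "K (x (t + real n) - (K ^^ n) (x t))" "g (t + real n)"] by simp
      qed
      then show "\<exists>a. \<forall>t\<in>T. a \<le> t \<longrightarrow> norm (x (t + real (Suc n)) - (K ^^ Suc n) (x t)) < e"
        by blast
    qed
  qed
  show ?thesis
    unfolding vanishing_iff
  proof (intro allI impI)
    fix e :: real assume e: "0 < e"
    obtain a0 where a0: "\<And>t. t \<in> T \<Longrightarrow> a0 \<le> t \<Longrightarrow> norm (x (t + real N) - (K ^^ N) (x t)) < e / 4"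
      using iterate[of N] e unfolding vanishing_iff by (meson divide_pos_pos zero_less_numeral)
    define a where "a = max a0 0"
    have step: "norm (x t) \<le> norm (x (t - real N)) / 2 + e / 4" if "t \<in> T" "a + real N \<le> t" for t
    proof -
      have "t - real N \<in> T" "a0 \<le> t - real N"
        using that T_diff[of t N] by (auto simp: a_def)
      then have "norm (x t - (K ^^ N) (x (t - real N))) < e / 4"
        using a0[of "t - real N"] by simp
      then show ?thesis
        using contr[of "x (t - real N)"] norm_triangle_sub[of "x t" "(K ^^ N) (x (t - real N))"] by simp
    qed
    obtain B0 where B0: "\<And>t. t \<in> T \<Longrightarrow> t \<le> a + real N \<Longrightarrow> norm (x t) \<le> B0"
      using bounded[of "a + real N"] by blast
    define B where "B = max B0 0"
    \<comment> \<open>\<open>e / 2\<close> is the fixed point of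
      \<open>s \<mapsto> s / 2 + e / 4\<close>, so every step of length \<open>N\<close> halves the
      excess over it.\<close>
    have decay: "norm (x t) \<le> B / 2 ^ k + e / 2" if "t \<in> T" "a + real (k * N) \<le> t" for k t
      using that
    proof (induction k arbitrary: t)
      case 0
      \<comment> \<open>For \<open>k = 0\<close> the bound must hold at all later times; an inner
        induction over windows of length \<open>N\<close> carries it on from
        \<open>{a..a + N}\<close>.\<close>
      have "norm (x t) \<le> B + e / 2" if "t \<in> T" "t \<le> a + real (Suc n * N)" "a \<le> t" for n t
        using that
      proof (induction n arbitrary: t)
        case 0
        then show ?case using B0[of t] e by (simp add: B_def)
      next
        case (Suc n)
        show ?case
        proof (cases "t \<le> a + real N")
          case True
          then show ?thesis using B0[of t] e Suc.prems by (simp add: B_def)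
        next
          case False
          have "norm (x (t - real N)) \<le> B + e / 2"
            using Suc.prems False T_diff[of t N] by (intro Suc.IH) (auto simp: a_def algebra_simps)
          moreover have "0 \<le> B" by (simp add: B_def)
          ultimately show ?thesis
            using step[of t] Suc.prems False by simp
        qed
      qed note upto = this
      obtain n where n: "t - a \<le> real n * real N"
        using N by (metis ex_less_of_nat_mult of_nat_0_less_iff less_imp_le)
      have "t \<le> a + real (Suc n * N)"
        using n by (simp add: algebra_simps add_increasing)
      then show ?case
        using upto[of t n] 0 by simp
    next
      case (Suc k)
      have ge: "a + real N \<le> t"
        using Suc.prems by (simp add: algebra_simps) (smt (verit) mult_nonneg_nonneg of_nat_0_le_iff)
      then have "t - real N \<in> T"
        using Suc.prems by (intro T_diff) (auto simp: a_def)
      then have "norm (x (t - real N)) \<le> B / 2 ^ k + e / 2"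
        using Suc.prems by (intro Suc.IH) (auto simp: algebra_simps)
      then have "norm (x (t - real N)) / 2 + e / 4 \<le> (B / 2 ^ k + e / 2) / 2 + e / 4"
        by simp
      also have "\<dots> = B / 2 ^ Suc k + e / 2"
        by (simp add: field_simps)
      finally show ?case
        using step[OF Suc.prems(1) ge] by (rule order_trans[rotated])
    qed
    have "(\<lambda>k. B / 2 ^ k) \<longlonglongrightarrow> 0"
      by (rule LIMSEQ_divide_realpow_zero) simp
    then have "\<forall>\<^sub>F k in sequentially. B / 2 ^ k < e / 2"
      using e by (intro order_tendstoD(2)) auto
    then obtain k where k: "B / 2 ^ k < e / 2"
      using eventually_happens'[OF sequentially_bot] by blast
    have "norm (x t) < e" if "t \<in> T" "a + real (k * N) \<le> t" for t
      using decay[OF that] k by argo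
    then show "\<exists>a. \<forall>t\<in>T. a \<le> t \<longrightarrow> norm (x t) < e"
      by blast
  qed
qed

section \<open>Semigroups in continuous time\<close>

text \<open>The point 0 is negligible; closed intervals suit the continuity and splitting
  rules.\<close>

lemma time_integral_halfline:
  fixes f :: "real \<Rightarrow> 'a::banach"
  shows "time_integral {0..} t f = integral {0..t} f"
proof -
  have "integral {0<..t} f = integral {0..t} f"
    by (rule integral_spike_set; rule negligible_subset[of "{0}"]) auto
  then show ?thesis
    by (simp add: time_integral_def)
qed

locale halfline_semigroup =
  fixes \<Phi> :: "real \<Rightarrow> 'a::{complex_normed_vector, banach} \<Rightarrow> 'a"
  assumes semigroup: "strongly_continuous_semigroup {0..} \<Phi>"
begin

lemma bounded_linear: "0 \<le> t \<Longrightarrow> bounded_linear (\<Phi> t)"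
  and scaleC: "0 \<le> t \<Longrightarrow> \<Phi> t (c *\<^sub>C v) = c *\<^sub>C \<Phi> t v"
  and at_zero: "\<Phi> 0 v = v"
  and add: "0 \<le> t \<Longrightarrow> 0 \<le> s \<Longrightarrow> \<Phi> (t + s) v = \<Phi> t (\<Phi> s v)"
  and strongly_continuous: "continuous_on {0..} (\<lambda>t. \<Phi> t v)"
  using semigroup by (auto simp: strongly_continuous_semigroup_def bounded_clinear_def)

lemma
  assumes "0 \<le> t"
  shows zero: "\<Phi> t 0 = 0"
    and plus: "\<Phi> t (v + w) = \<Phi> t v + \<Phi> t w"
    and diff: "\<Phi> t (v - w) = \<Phi> t v - \<Phi> t w"
    and scaleR: "\<Phi> t (r *\<^sub>R v) = r *\<^sub>R \<Phi> t v"
  using bounded_linear.linear[OF bounded_linear[OF assms]]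
  by (simp_all add: linear_0 linear_add linear_diff linear_scale)

text \<open>Each orbit is bounded on a compact time interval, and uniform boundedness turns this
  into one constant for all vectors.\<close>

lemma locally_bounded:
  obtains C where "0 \<le> C" "\<And>t v. t \<in> {0..a} \<Longrightarrow> norm (\<Phi> t v) \<le> C * norm v"
proof (rule uniform_boundedness[of "{0..a}" \<Phi>])
  show "\<exists>C. \<forall>t\<in>{0..a}. norm (\<Phi> t v) \<le> C" for v
  proof -
    have "compact ((\<lambda>t. \<Phi> t v) ` {0..a})"
      by (intro compact_continuous_image continuous_on_subset[OF strongly_continuous]) auto
    then obtain C where "\<forall>w\<in>(\<lambda>t. \<Phi> t v) ` {0..a}. norm w \<le> C"
      by (meson bounded_iff compact_imp_bounded)
    then show ?thesis by auto
  qed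
qed (auto simp: bounded_linear)

text \<open>The integrand is split as
  \<open>\<Phi> (t - r) (g r - g s) + \<Phi> (t - r) (g s)\<close>. The first part is small by local
  boundedness, the second converges by strong continuity.\<close>

lemma continuous_on_convolution:
  assumes g: "continuous_on {0..t} g"
  shows "continuous_on {0..t} (\<lambda>s. \<Phi> (t - s) (g s))"
  unfolding continuous_on_def
proof
  fix s assume s: "s \<in> {0..t}"
  obtain C where C: "0 \<le> C" "\<And>r v. r \<in> {0..t} \<Longrightarrow> norm (\<Phi> r v) \<le> C * norm v"
    using locally_bounded by blast
  have "((\<lambda>r. C * norm (g r - g s)) \<longlongrightarrow> 0) (at s within {0..t})"
    using g s unfolding continuous_on_def
    by (intro tendsto_mult_right_zero tendsto_norm_zero) (simp add: LIM_zero)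
  then have "((\<lambda>r. \<Phi> (t - r) (g r - g s)) \<longlongrightarrow> 0) (at s within {0..t})"
  proof (rule Lim_null_comparison[rotated])
    show "\<forall>\<^sub>F r in at s within {0..t}. norm (\<Phi> (t - r) (g r - g s)) \<le> C * norm (g r - g s)"
      using C(2) by (auto simp: eventually_at_filter)
  qed
  moreover have "continuous_on {0..t} (\<lambda>r. \<Phi> (t - r) (g s))"
    by (rule continuous_on_compose2[OF strongly_continuous]) (auto intro!: continuous_intros)
  then have "((\<lambda>r. \<Phi> (t - r) (g s)) \<longlongrightarrow> \<Phi> (t - s) (g s)) (at s within {0..t})"
    using s by (simp add: continuous_on_def)
  ultimately have "((\<lambda>r. \<Phi> (t - r) (g r - g s) + \<Phi> (t - r) (g s)) \<longlongrightarrow> 0 + \<Phi> (t - s) (g s)) (at s within {0..t})"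
    by (rule tendsto_add)
  moreover have "\<forall>\<^sub>F r in at s within {0..t}. \<Phi> (t - r) (g r - g s) + \<Phi> (t - r) (g s) = \<Phi> (t - r) (g r)"
    by (auto simp: eventually_at_filter diff)
  ultimately show "((\<lambda>r. \<Phi> (t - r) (g r)) \<longlongrightarrow> \<Phi> (t - s) (g s)) (at s within {0..t})"
    by (auto elim: Lim_transform_eventually)
qed

lemma norm_convolution_le:
  assumes g: "continuous_on {0..t} g" and t: "0 \<le> t"
    and C: "0 \<le> C" "\<And>r v. r \<in> {0..t} \<Longrightarrow> norm (\<Phi> r v) \<le> C * norm v"
    and e: "\<And>s. s \<in> {0..t} \<Longrightarrow> norm (g s) \<le> e"
  shows "norm (integral {0..t} (\<lambda>s. \<Phi> (t - s) (g s))) \<le> C * e * t"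
proof -
  have "norm (\<Phi> (t - s) (g s)) \<le> C * e" if "s \<in> {0..t}" for s
    using C(2)[of "t - s" "g s"] mult_left_mono[OF e[OF that] C(1)] that by auto
  then show ?thesis
    using integral_bound[OF t continuous_on_convolution[OF g]] by simp
qed

section \<open>Trajectories in continuous time: translation, differentiation, decay\<close>

lemma evolution_relationD:
  assumes "(u, x) \<in> evolution_relation {0..} \<Phi>"
  shows "u \<in> C_infinity_loc {0..}" and "x \<in> C_infinity_loc {0..}"
    and "0 \<le> t \<Longrightarrow> x t = \<Phi> t (x 0) + integral {0..t} (\<lambda>s. \<Phi> (t - s) (u s))"
  using assms
  unfolding evolution_relation_def time_integral_halfline Ball_def atLeast_iff mem_Collect_eq prod.case
  by blast+

lemma evolution_relationI:
  assumes "u \<in> C_infinity_loc {0..}" and "x \<in> C_infinity_loc {0..}"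
    and "\<And>t. 0 \<le> t \<Longrightarrow> x t = \<Phi> t (x 0) + integral {0..t} (\<lambda>s. \<Phi> (t - s) (u s))"
  shows "(u, x) \<in> evolution_relation {0..} \<Phi>"
  unfolding evolution_relation_def time_integral_halfline Ball_def atLeast_iff mem_Collect_eq prod.case
  using assms by blast

lemma evolution_continuous_on:
  assumes "(u, x) \<in> evolution_relation {0..} \<Phi>"
  shows "continuous_on {0..} u" and "continuous_on {0..} x"
  using C_infinity_loc_continuous_on[OF evolution_relationD(1)[OF assms], of 0]
    C_infinity_loc_continuous_on[OF evolution_relationD(2)[OF assms], of 0] by simp_all

text \<open>The trajectory restarts at time \<open>h\<close>: the integral is split at
  \<open>h\<close>, and factoring \<open>\<Phi> t\<close> out of the first piece reassembles the
  state \<open>x h\<close>.\<close>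

lemma evolution_translate:
  assumes ux: "(u, x) \<in> evolution_relation {0..} \<Phi>" and t: "0 \<le> t" and h: "0 \<le> h"
  shows "x (t + h) = \<Phi> t (x h) + integral {0..t} (\<lambda>s. \<Phi> (t - s) (u (s + h)))"
proof -
  let ?f = "\<lambda>s. \<Phi> (t + h - s) (u s)"
  note u = evolution_continuous_on(1)[OF ux]
  note x = evolution_relationD(3)[OF ux]
  have conv: "(\<lambda>s. \<Phi> (r - s) (u s)) integrable_on {0..r}" for r
    by (intro integrable_continuous_interval continuous_on_convolution continuous_on_subset[OF u]) auto
  have "\<Phi> t (integral {0..h} (\<lambda>s. \<Phi> (h - s) (u s))) = integral {0..h} (\<Phi> t \<circ> (\<lambda>s. \<Phi> (h - s) (u s)))"
    by (rule integral_linear[OF conv bounded_linear[OF t], symmetric])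
  also have "\<dots> = integral {0..h} ?f"
    using t by (intro integral_cong) (simp add: add[symmetric] algebra_simps)
  finally have "integral {0..h} ?f = \<Phi> t (integral {0..h} (\<lambda>s. \<Phi> (h - s) (u s)))" ..
  moreover have "integral {h..t + h} ?f = integral {0..t} (\<lambda>s. \<Phi> (t - s) (u (s + h)))"
    using integral_shift_real_ivl[of h h "t + h" ?f] by simp
  moreover have "integral {0..h} ?f + integral {h..t + h} ?f = integral {0..t + h} ?f"
    using t h by (intro Henstock_Kurzweil_Integration.integral_combine conv) auto
  ultimately show ?thesis
    by (simp add: x[of "t + h"] x[of h] add plus t h add.assoc)
qed

text \<open>By \<open>evolution_translate\<close> the difference quotients of \<open>u\<close> and
  \<open>x\<close> satisfy the evolution equation. They converge uniformly on \<open>{0..t}\<close>,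
  where \<open>\<Phi>\<close> is bounded, so the equation passes to the limit.\<close>

lemma evolution_deriv:
  assumes ux: "(u, x) \<in> evolution_relation {0..} \<Phi>"
  shows "(halfline_deriv (Suc 0) u, halfline_deriv (Suc 0) x) \<in> evolution_relation {0..} \<Phi>"
proof -
  let ?u' = "halfline_deriv (Suc 0) u" and ?x' = "halfline_deriv (Suc 0) x"
  note u = evolution_relationD(1)[OF ux] and x = evolution_relationD(2)[OF ux]
  have cont_u: "continuous_on {0..} u" and cont_u': "continuous_on {0..} ?u'"
    using C_infinity_loc_continuous_on[OF u, of 0] C_infinity_loc_continuous_on[OF u] by simp_all
  have "?x' t = \<Phi> t (?x' 0) + integral {0..t} (\<lambda>s. \<Phi> (t - s) (?u' s))" if t: "0 \<le> t" for t
  proof -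
    obtain C where C: "0 \<le> C" "\<And>r v. r \<in> {0..t} \<Longrightarrow> norm (\<Phi> r v) \<le> C * norm v"
      using locally_bounded by blast
    define R where "R = ?x' t - (\<Phi> t (?x' 0) + integral {0..t} (\<lambda>s. \<Phi> (t - s) (?u' s)))"
    have "norm R \<le> 0 + e" if e: "0 < e" for e
    proof -
      \<comment> \<open>Chosen so that the errors from the initial value, the integral and the value
        at \<open>t\<close>, namely \<open>C * d\<close>, \<open>C * d * t\<close> and
        \<open>d\<close>, add up to \<open>e\<close>.\<close>
      define d where "d = e / (1 + C + C * t)"
      have pos: "0 < 1 + C + C * t"
        using C t by (simp add: add_pos_nonneg)
      then have d: "0 < d"
        using e by (simp add: d_def)
      obtain \<delta>1 where \<delta>1: "0 < \<delta>1" "\<And>h s. 0 < h \<Longrightarrow> h < \<delta>1 \<Longrightarrow> s \<in> {0..t} \<Longrightarrow>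
          norm ((x (s + h) - x s) /\<^sub>R h - ?x' s) \<le> d"
        using difference_quotient_uniform[OF x d] by blast
      obtain \<delta>2 where \<delta>2: "0 < \<delta>2" "\<And>h s. 0 < h \<Longrightarrow> h < \<delta>2 \<Longrightarrow> s \<in> {0..t} \<Longrightarrow>
          norm ((u (s + h) - u s) /\<^sub>R h - ?u' s) \<le> d"
        using difference_quotient_uniform[OF u d] by blast
      define h where "h = min \<delta>1 \<delta>2 / 2"
      have h: "0 < h" "h < \<delta>1" "h < \<delta>2"
        using \<delta>1(1) \<delta>2(1) by (auto simp: h_def)
      define q where "q s = (u (s + h) - u s) /\<^sub>R h - ?u' s" for s
      have uh: "continuous_on {0..t} (\<lambda>s. u (s + h))"
        using h by (intro continuous_on_compose2[OF cont_u] continuous_intros) auto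
      have cont: "continuous_on {0..t} u" "continuous_on {0..t} ?u'"
        using cont_u cont_u' by (auto elim: continuous_on_subset)
      have q: "continuous_on {0..t} q"
        unfolding q_def by (intro continuous_intros uh cont)
      have int: "(\<lambda>s. \<Phi> (t - s) (g s)) integrable_on {0..t}" if "continuous_on {0..t} g" for g
        by (intro integrable_continuous_interval continuous_on_convolution that)
      have "integral {0..t} (\<lambda>s. \<Phi> (t - s) (q s))
          = integral {0..t} (\<lambda>s. (\<Phi> (t - s) (u (s + h)) - \<Phi> (t - s) (u s)) /\<^sub>R h - \<Phi> (t - s) (?u' s))"
        by (intro integral_cong) (simp add: q_def diff scaleR)
      also have "\<dots> = (integral {0..t} (\<lambda>s. \<Phi> (t - s) (u (s + h))) - integral {0..t} (\<lambda>s. \<Phi> (t - s) (u s))) /\<^sub>R h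
          - integral {0..t} (\<lambda>s. \<Phi> (t - s) (?u' s))"
        by (simp add: integral_diff integrable_diff integrable_cmul int uh cont)
      finally have int_q: "integral {0..t} (\<lambda>s. \<Phi> (t - s) (q s)) = \<dots>" .
      have "x (t + h) - x t = \<Phi> t (x h - x 0) + (integral {0..t} (\<lambda>s. \<Phi> (t - s) (u (s + h)))
          - integral {0..t} (\<lambda>s. \<Phi> (t - s) (u s)))"
        using evolution_translate[OF ux t, of h] evolution_translate[OF ux t, of 0] h t
        by (simp add: diff)
      then have "(x (t + h) - x t) /\<^sub>R h = \<Phi> t ((x h - x 0) /\<^sub>R h)
          + (integral {0..t} (\<lambda>s. \<Phi> (t - s) (u (s + h))) - integral {0..t} (\<lambda>s. \<Phi> (t - s) (u s))) /\<^sub>R h"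
        using t by (simp add: scaleR scaleR_add_right)
      then have "R = \<Phi> t ((x h - x 0) /\<^sub>R h - ?x' 0) + integral {0..t} (\<lambda>s. \<Phi> (t - s) (q s))
          - ((x (t + h) - x t) /\<^sub>R h - ?x' t)"
        using t by (simp add: R_def int_q diff)
      also have "norm \<dots> \<le> norm (\<Phi> t ((x h - x 0) /\<^sub>R h - ?x' 0))
          + norm (integral {0..t} (\<lambda>s. \<Phi> (t - s) (q s))) + norm ((x (t + h) - x t) /\<^sub>R h - ?x' t)"
        using norm_triangle_ineq4 norm_triangle_ineq by (meson add_right_mono order_trans)
      also have "\<dots> \<le> C * d + C * d * t + d"
      proof (intro add_mono)
        have "norm ((x (0 + h) - x 0) /\<^sub>R h - ?x' 0) \<le> d"
          using h t by (intro \<delta>1) auto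
        then show "norm (\<Phi> t ((x h - x 0) /\<^sub>R h - ?x' 0)) \<le> C * d"
          using C(2)[of t "(x h - x 0) /\<^sub>R h - ?x' 0"] C(1) t by (auto elim!: order_trans intro!: mult_left_mono)
        show "norm (integral {0..t} (\<lambda>s. \<Phi> (t - s) (q s))) \<le> C * d * t"
          using h by (intro norm_convolution_le q t C) (auto simp: q_def intro!: \<delta>2)
        show "norm ((x (t + h) - x t) /\<^sub>R h - ?x' t) \<le> d"
          using h t by (intro \<delta>1) auto
      qed
      also have "\<dots> = d * (1 + C + C * t)"
        by (simp add: algebra_simps)
      also have "\<dots> = e"
        using pos by (simp add: d_def)
      finally show ?thesis by simp
    qed
    then have "norm R \<le> 0"
      by (rule field_le_epsilon)
    then show ?thesis by (simp add: R_def)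
  qed
  then show ?thesis
    by (rule evolution_relationI[OF C_infinity_loc_deriv[OF u] C_infinity_loc_deriv[OF x]])
qed

lemma evolution_deriv_iterate:
  assumes "(u, x) \<in> evolution_relation {0..} \<Phi>"
  shows "(halfline_deriv k u, halfline_deriv k x) \<in> evolution_relation {0..} \<Phi>"
proof (induction k)
  case (Suc k)
  from evolution_deriv[OF this] show ?case
    by (simp only: halfline_deriv_Suc_left[of k, symmetric])
qed (simp add: assms)

text \<open>This is the forcing term of the unit step recursion. At time \<open>t\<close> it sees
  the input only on \<open>{t..t + 1}\<close>, and \<open>\<Phi>\<close> is bounded on
  \<open>{0..1}\<close>.\<close>

lemma vanishing_convolution_unit_interval:
  assumes u: "continuous_on {0..} u" and van: "vanishing {0..} u"
  shows "vanishing {0..} (\<lambda>t. integral {0..1} (\<lambda>s. \<Phi> (1 - s) (u (s + t))))"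
  unfolding vanishing_iff
proof (intro allI impI)
  fix e :: real assume e: "0 < e"
  obtain C where C: "0 \<le> C" "\<And>r v. r \<in> {0..1} \<Longrightarrow> norm (\<Phi> r v) \<le> C * norm v"
    using locally_bounded by blast
  define d where "d = e / (1 + C)"
  have d: "0 < d" "C * d < e"
    using e C by (simp_all add: d_def field_simps)
  obtain a where a: "\<And>t. 0 \<le> t \<Longrightarrow> a \<le> t \<Longrightarrow> norm (u t) < d"
    using van d unfolding vanishing_iff by force
  have "norm (integral {0..1} (\<lambda>s. \<Phi> (1 - s) (u (s + t)))) < e" if t: "0 \<le> t" "a \<le> t" for t
  proof -
    have "norm (integral {0..1} (\<lambda>s. \<Phi> (1 - s) (u (s + t)))) \<le> C * d * 1"
    proof (rule norm_convolution_le)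
      show "continuous_on {0..1} (\<lambda>s. u (s + t))"
        using t by (intro continuous_on_compose2[OF u] continuous_intros) auto
      show "norm (u (s + t)) \<le> d" if "s \<in> {0..1}" for s
        using a[of "s + t"] t that by auto
    qed (use C in auto)
    then show ?thesis using d by simp
  qed
  then show "\<exists>a. \<forall>t\<in>{0..}. a \<le> t \<longrightarrow> norm (integral {0..1} (\<lambda>s. \<Phi> (1 - s) (u (s + t)))) < e"
    by auto
qed

lemma VIVO_halfline:
  assumes N: "0 < N" and contr: "\<And>v. norm ((\<Phi> 1 ^^ N) v) \<le> norm v / 2"
  shows "VIVO {0..} (evolution_relation {0..} \<Phi>)"
proof -
  have "vanishing {0..} x"
    if ux: "(u, x) \<in> evolution_relation {0..} \<Phi>" and van: "vanishing {0..} u" for u x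
  proof (rule vanishing_recursion[OF _ bounded_linear N contr])
    note u = evolution_continuous_on(1)[OF ux] and x = evolution_continuous_on(2)[OF ux]
    show "vanishing {0..} (\<lambda>t. integral {0..1} (\<lambda>s. \<Phi> (1 - s) (u (s + t))))"
      using u van by (rule vanishing_convolution_unit_interval)
    show "x (t + 1) = \<Phi> 1 (x t) + integral {0..1} (\<lambda>s. \<Phi> (1 - s) (u (s + t)))" if "t \<in> {0..}" for t
      using evolution_translate[OF ux, of 1 t] that by (simp add: add.commute)
    show "\<exists>B. \<forall>t\<in>{0..}. t \<le> a \<longrightarrow> norm (x t) \<le> B" for a
    proof -
      have "compact (x ` {0..a})"
        by (intro compact_continuous_image continuous_on_subset[OF x]) auto
      then obtain B where "\<forall>v\<in>x ` {0..a}. norm v \<le> B"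
        by (meson bounded_iff compact_imp_bounded)
      then show ?thesis by (intro exI[of _ B]) auto
    qed
  qed auto
  then show ?thesis
    by (auto simp: VIVO_def)
qed

text \<open>VIVO is applied to each pair of \<open>k\<close>-th derivatives, which again lies in the
  relation.\<close>

lemma smoothly_VIVO_halfline:
  assumes "VIVO {0..} (evolution_relation {0..} \<Phi>)"
  shows "smoothly_VIVO {0..} (evolution_relation {0..} \<Phi>)"
proof -
  have "vanishing {0..} (halfline_deriv k x)"
    if "(u, x) \<in> evolution_relation {0..} \<Phi>" "smoothly_vanishing {0..} u" for u x k
    using assms evolution_deriv_iterate[OF that(1), of k] that(2)
    by (auto simp: VIVO_def smoothly_vanishing_def)
  then show ?thesis
    by (auto simp: smoothly_VIVO_def smoothly_vanishing_def)
qed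

end

section \<open>Smoothness of orbits of eigenvectors\<close>

context halfline_semigroup
begin

lemma orbit_integrable: "0 \<le> a \<Longrightarrow> (\<lambda>s. \<Phi> s w) integrable_on {a..b}"
  by (intro integrable_continuous_interval continuous_on_subset[OF strongly_continuous]) auto

text \<open>Shifting the window \<open>{0..h}\<close> by \<open>t\<close> trades one end piece for
  another. In the resulting form \<open>t\<close> occurs only as an upper limit of
  integration.\<close>

lemma semigroup_integral_orbit:
  assumes t: "0 \<le> t" and h: "0 \<le> h"
  shows "\<Phi> t (integral {0..h} (\<lambda>s. \<Phi> s w))
    = integral {0..h} (\<lambda>s. \<Phi> s w) + integral {0..t} (\<lambda>s. \<Phi> s (\<Phi> h w - w))"
proof -
  let ?f = "\<lambda>s. \<Phi> s w"
  have shift: "integral {0..r} (\<lambda>s. \<Phi> s (\<Phi> q w)) = integral {q..q + r} ?f" if "0 \<le> q" for q r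
  proof -
    have "integral {0..r} (\<lambda>s. \<Phi> s (\<Phi> q w)) = integral {0..r} (\<lambda>s. ?f (s + q))"
      using that by (intro integral_cong) (simp add: add)
    then show ?thesis
      using integral_shift_real_ivl[of q q "q + r" ?f] by simp
  qed
  have "\<Phi> t (integral {0..h} ?f) = integral {0..h} (\<Phi> t \<circ> ?f)"
    by (rule integral_linear[OF orbit_integrable bounded_linear[OF t], symmetric]) simp
  also have "\<dots> = integral {0..h} (\<lambda>s. \<Phi> s (\<Phi> t w))"
    using t by (intro integral_cong) (simp add: add[symmetric] add.commute)
  also have "\<dots> = integral {t..t + h} ?f"
    by (rule shift[OF t])
  finally have left: "\<Phi> t (integral {0..h} ?f) = integral {t..t + h} ?f" .
  have "integral {0..t} (\<lambda>s. \<Phi> s (\<Phi> h w - w)) = integral {0..t} (\<lambda>s. \<Phi> s (\<Phi> h w) - \<Phi> s w)"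
    by (intro integral_cong) (simp add: diff)
  also have "\<dots> = integral {h..h + t} ?f - integral {0..t} ?f"
    by (simp add: Henstock_Kurzweil_Integration.integral_diff orbit_integrable shift[OF h])
  finally have right: "integral {0..t} (\<lambda>s. \<Phi> s (\<Phi> h w - w)) = integral {h..h + t} ?f - integral {0..t} ?f" .
  have "integral {0..t} ?f + integral {t..t + h} ?f = integral {0..t + h} ?f"
    "integral {0..h} ?f + integral {h..t + h} ?f = integral {0..t + h} ?f"
    using t h by (intro Henstock_Kurzweil_Integration.integral_combine orbit_integrable; simp)+
  then show ?thesis
    unfolding left right by (simp add: add.commute algebra_simps)
qed

text \<open>The fundamental theorem of calculus applied to \<open>semigroup_integral_orbit\<close>.
  The derivative is again an orbit, which permits iteration.\<close>

lemma orbit_integral_has_vector_derivative: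
  assumes t: "0 \<le> t" and h: "0 \<le> h"
  shows "((\<lambda>t. \<Phi> t (integral {0..h} (\<lambda>s. \<Phi> s w))) has_vector_derivative \<Phi> t (\<Phi> h w - w))
    (at t within {0..})"
proof -
  let ?z = "\<Phi> h w - w"
  have "((\<lambda>r. integral {0..r} (\<lambda>s. \<Phi> s ?z)) has_vector_derivative \<Phi> t ?z) (at t within {0..t + 1})"
    using t by (intro integral_has_vector_derivative continuous_on_subset[OF strongly_continuous]) auto
  \<comment> \<open>Near \<open>t\<close> the interval and the half-line coincide, also at the
    endpoint 0.\<close>
  moreover have "at t within {0..t + 1} = at t within {0..}"
    by (rule at_within_nhd[of t "{..<t + 1}"]) auto
  ultimately have "((\<lambda>r. integral {0..h} (\<lambda>s. \<Phi> s w) + integral {0..r} (\<lambda>s. \<Phi> s ?z))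
      has_vector_derivative 0 + \<Phi> t ?z) (at t within {0..})"
    by (intro has_vector_derivative_add has_vector_derivative_const) simp
  then have "((\<lambda>r. integral {0..h} (\<lambda>s. \<Phi> s w) + integral {0..r} (\<lambda>s. \<Phi> s ?z))
      has_vector_derivative \<Phi> t ?z) (at t within {0..})"
    by simp
  then show ?thesis
    by (rule has_vector_derivative_transform[rotated 2]) (use t h in \<open>simp_all add: semigroup_integral_orbit\<close>)
qed

text \<open>\<open>\<Phi> 1\<close> acts on the eigenspace as the invertible scalar
  \<open>c\<close>, so bounded sequences of eigenvectors have convergent subsequences. This makes
  strong continuity at 0 uniform over unit eigenvectors.\<close>

lemma uniformly_continuous_at_zero_on_eigenspace:
  assumes K: "compact_operator (\<Phi> 1)" and c: "c \<noteq> 0"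
  obtains h where "0 < h"
    "\<And>s v. s \<in> {0..h} \<Longrightarrow> \<Phi> 1 v = c *\<^sub>C v \<Longrightarrow> norm (\<Phi> s v - v) \<le> norm v / 2"
proof (rule ccontr)
  assume "\<not> thesis"
  then have "\<forall>n. \<exists>s v. s \<in> {0..inverse (real (Suc n))} \<and> \<Phi> 1 v = c *\<^sub>C v \<and> norm v / 2 < norm (\<Phi> s v - v)"
    using that by (metis not_le inverse_positive_iff_positive of_nat_0_less_iff zero_less_Suc)
  then obtain s v where s: "\<And>n. s n \<in> {0..inverse (real (Suc n))}"
    and v: "\<And>n. \<Phi> 1 (v n) = c *\<^sub>C v n" and large: "\<And>n. norm (v n) / 2 < norm (\<Phi> (s n) (v n) - v n)"
    by metis
  have s_nonneg: "0 \<le> s n" "s n \<le> 1" for n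
    using s[of n] by (auto intro: order_trans simp: inverse_le_1_iff)
  define y where "y n = v n /\<^sub>R norm (v n)" for n
  have v_nz: "v n \<noteq> 0" for n
    using large[of n] s_nonneg(1)[of n] by (auto simp: zero)
  have norm_y: "norm (y n) = 1" for n
    using v_nz[of n] by (simp add: y_def)
  have y_eigen: "\<Phi> 1 (y n) = c *\<^sub>C y n" for n
    using v[of n] by (simp add: y_def scaleR scaleC.scaleR_right)
  have "\<Phi> (s n) (y n) - y n = (\<Phi> (s n) (v n) - v n) /\<^sub>R norm (v n)" for n
    using s_nonneg by (simp add: y_def scaleR scaleR_diff_right)
  then have y_large: "1 / 2 < norm (\<Phi> (s n) (y n) - y n)" for n
    using large[of n] v_nz[of n] by (simp add: pos_less_divide_eq inverse_eq_divide)
  have "bounded (range y)"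
    by (rule boundedI[of _ 1]) (auto simp: norm_y)
  then obtain r l where r: "strict_mono r" and l: "(\<lambda>n. \<Phi> 1 (y (r n))) \<longlonglongrightarrow> l"
    using compact_operator_convergent_subsequence[OF K, of y] by blast
  \<comment> \<open>Since \<open>\<Phi> 1 (y n) = c y n\<close>, dividing the limit of the images by
    \<open>c\<close> gives the limit of the vectors themselves.\<close>
  define y0 where "y0 = inverse c *\<^sub>C l"
  have "(\<lambda>n. inverse c *\<^sub>C \<Phi> 1 (y (r n))) \<longlonglongrightarrow> y0"
    unfolding y0_def by (rule scaleC.tendsto[OF tendsto_const l])
  then have y_lim: "(\<lambda>n. y (r n)) \<longlonglongrightarrow> y0"
    using c by (simp add: y_eigen scaleC_scaleC)
  have "s \<longlonglongrightarrow> 0"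
    using s by (intro tendsto_sandwich[OF _ _ tendsto_const LIMSEQ_inverse_real_of_nat]) auto
  then have s_lim: "(\<lambda>n. s (r n)) \<longlonglongrightarrow> 0"
    using LIMSEQ_subseq_LIMSEQ[OF _ r, of s 0] by (simp add: o_def)
  have "(\<lambda>n. \<Phi> (s (r n)) y0) \<longlonglongrightarrow> \<Phi> 0 y0"
    by (rule continuous_on_tendsto_compose[OF strongly_continuous s_lim]) (auto simp: s_nonneg)
  then have "(\<lambda>n. \<Phi> (s (r n)) y0 - y0) \<longlonglongrightarrow> 0"
    by (simp add: at_zero LIM_zero)
  then have lim1: "(\<lambda>n. norm (\<Phi> (s (r n)) y0 - y0)) \<longlonglongrightarrow> 0"
    by (rule tendsto_norm_zero)
  obtain C where C: "0 \<le> C" "\<And>t v. t \<in> {0..1} \<Longrightarrow> norm (\<Phi> t v) \<le> C * norm v"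
    using locally_bounded by blast
  have lim2: "(\<lambda>n. norm (y (r n) - y0)) \<longlonglongrightarrow> 0"
    by (intro tendsto_norm_zero LIM_zero y_lim)
  have "(\<lambda>n. C * norm (y (r n) - y0) + norm (\<Phi> (s (r n)) y0 - y0) + norm (y (r n) - y0)) \<longlonglongrightarrow> C * 0 + 0 + 0"
    by (intro tendsto_intros lim1 lim2)
  \<comment> \<open>Replacing \<open>y (r n)\<close> by \<open>y0\<close> costs the two outer terms;
    all three terms tend to 0, a contradiction.\<close>
  moreover have "1 / 2 \<le> C * norm (y (r n) - y0) + norm (\<Phi> (s (r n)) y0 - y0) + norm (y (r n) - y0)" for n
  proof -
    have "\<Phi> (s (r n)) (y (r n)) - y (r n)
        = \<Phi> (s (r n)) (y (r n) - y0) + (\<Phi> (s (r n)) y0 - y0) - (y (r n) - y0)"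
      using s_nonneg by (simp add: diff)
    also have "norm \<dots> \<le> norm (\<Phi> (s (r n)) (y (r n) - y0)) + norm (\<Phi> (s (r n)) y0 - y0) + norm (y (r n) - y0)"
      by (meson norm_triangle_ineq4 norm_triangle_ineq add_right_mono order_trans)
    also have "norm (\<Phi> (s (r n)) (y (r n) - y0)) \<le> C * norm (y (r n) - y0)"
      using s_nonneg by (intro C) auto
    finally show ?thesis
      using y_large[of "r n"] by simp
  qed
  ultimately have "1 / 2 \<le> C * 0 + 0 + (0 :: real)"
    by (intro tendsto_lowerbound[OF _ always_eventually]) auto
  then show False by simp
qed

text \<open>By \<open>half\<close> the averaging map \<open>A\<close> is within 1/2 of the identity
  on the eigenspace \<open>E\<close>. Hence \<open>w \<mapsto> v / h + (w - A w)\<close> is a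
  contraction of the complete space \<open>E\<close>, and its fixed point satisfies
  \<open>A w = v / h\<close>.\<close>

lemma integral_orbit_surj_on_eigenspace:
  assumes h: "0 < h"
    and half: "\<And>s v. s \<in> {0..h} \<Longrightarrow> \<Phi> 1 v = c *\<^sub>C v \<Longrightarrow> norm (\<Phi> s v - v) \<le> norm v / 2"
    and v: "\<Phi> 1 v = c *\<^sub>C v"
  obtains w where "\<Phi> 1 w = c *\<^sub>C w" "v = integral {0..h} (\<lambda>s. \<Phi> s w)"
proof -
  define E where "E = {v. \<Phi> 1 v = c *\<^sub>C v}"
  define A where "A w = integral {0..h} (\<lambda>s. \<Phi> s w) /\<^sub>R h" for w
  have E_diff: "w1 - w2 \<in> E" if "w1 \<in> E" "w2 \<in> E" for w1 w2
    using that by (simp add: E_def diff scaleC.diff_right)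
  have E_scaleR: "r *\<^sub>R w \<in> E" if "w \<in> E" for r w
    using that by (simp add: E_def scaleR scaleC.scaleR_right)
  have E_add: "w1 + w2 \<in> E" if "w1 \<in> E" "w2 \<in> E" for w1 w2
    using that by (simp add: E_def plus scaleC_add_right)
  have bl_c: "bounded_linear (\<lambda>x::'a. c *\<^sub>C x)"
    by (rule scaleC.bounded_linear_right)
  have A_E: "A w \<in> E" if "w \<in> E" for w
  proof -
    have "\<Phi> 1 (integral {0..h} (\<lambda>s. \<Phi> s w)) = integral {0..h} (\<Phi> 1 \<circ> (\<lambda>s. \<Phi> s w))"
      by (rule integral_linear[OF orbit_integrable bounded_linear, symmetric]) simp_all
    also have "\<dots> = integral {0..h} ((*\<^sub>C) c \<circ> (\<lambda>s. \<Phi> s w))"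
    proof (rule integral_cong)
      fix s assume "s \<in> {0..h}"
      then have "\<Phi> 1 (\<Phi> s w) = \<Phi> s (\<Phi> 1 w)"
        by (simp add: add[symmetric] add.commute)
      then show "(\<Phi> 1 \<circ> (\<lambda>s. \<Phi> s w)) s = ((*\<^sub>C) c \<circ> (\<lambda>s. \<Phi> s w)) s"
        using that \<open>s \<in> {0..h}\<close> by (simp add: E_def scaleC)
    qed
    also have "\<dots> = c *\<^sub>C integral {0..h} (\<lambda>s. \<Phi> s w)"
      by (rule integral_linear[OF orbit_integrable bl_c]) simp
    finally show ?thesis
      unfolding A_def by (intro E_scaleR) (simp add: E_def)
  qed
  have A_diff: "A (w1 - w2) = A w1 - A w2" for w1 w2
  proof -
    have "integral {0..h} (\<lambda>s. \<Phi> s (w1 - w2)) = integral {0..h} (\<lambda>s. \<Phi> s w1 - \<Phi> s w2)"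
      by (intro integral_cong) (simp add: diff)
    then show ?thesis
      by (simp add: A_def Henstock_Kurzweil_Integration.integral_diff orbit_integrable scaleR_diff_right)
  qed
  have A_near: "norm (w - A w) \<le> 1 / 2 * norm w" if w: "w \<in> E" for w
  proof -
    have "integral {0..h} (\<lambda>s. \<Phi> s w - w) = integral {0..h} (\<lambda>s. \<Phi> s w) - h *\<^sub>R w"
      using h by (subst Henstock_Kurzweil_Integration.integral_diff)
        (simp_all add: orbit_integrable integrable_const_ivl)
    then have "w - A w = - (integral {0..h} (\<lambda>s. \<Phi> s w - w) /\<^sub>R h)"
      using h by (simp add: A_def scaleR_diff_right)
    moreover have "norm (integral {0..h} (\<lambda>s. \<Phi> s w - w)) \<le> norm w / 2 * (h - 0)"
      using h w half
      by (intro integral_bound continuous_on_diff continuous_on_const continuous_on_subset[OF strongly_continuous])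
        (auto simp: E_def)
    ultimately show ?thesis
      using h by (simp add: inverse_eq_divide pos_divide_le_eq)
  qed
  have "\<exists>!w\<in>E. v /\<^sub>R h + (w - A w) = w"
  proof (rule Banach_fix[of E "1 / 2"])
    have "closed E"
      unfolding E_def
      by (intro closed_Collect_eq linear_continuous_on[OF bounded_linear] linear_continuous_on[OF bl_c]) simp
    then show "complete E"
      by (simp add: complete_eq_closed)
    show "E \<noteq> {}"
      using v by (auto simp: E_def)
    show "(\<lambda>w. v /\<^sub>R h + (w - A w)) ` E \<subseteq> E"
      using v by (auto intro!: E_add E_diff E_scaleR A_E simp: E_def[symmetric]) (simp add: E_def)
    show "dist (v /\<^sub>R h + (w1 - A w1)) (v /\<^sub>R h + (w2 - A w2)) \<le> 1 / 2 * dist w1 w2"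
      if "w1 \<in> E" "w2 \<in> E" for w1 w2
      using A_near[OF E_diff[OF that]] by (simp add: dist_norm A_diff algebra_simps)
  qed simp_all
  then obtain w where w: "w \<in> E" "v /\<^sub>R h + (w - A w) = w"
    by blast
  then have "h *\<^sub>R (v /\<^sub>R h) = h *\<^sub>R A w"
    by (simp add: algebra_simps)
  then have "v = integral {0..h} (\<lambda>s. \<Phi> s w)"
    using h by (simp add: A_def)
  then show thesis
    using w that by (simp add: E_def)
qed

text \<open>Every eigenvector is an orbit integral of another one, so its orbit has as derivative
  the orbit of some \<open>D v\<close> in the same eigenspace. Iterating \<open>D\<close> supplies
  the whole tower of derivatives.\<close>

lemma eigenvector_orbit_smooth:
  assumes K: "compact_operator (\<Phi> 1)" and c: "c \<noteq> 0" and v: "\<Phi> 1 v = c *\<^sub>C v"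
  shows "(\<lambda>t. \<Phi> t v) \<in> C_infinity_loc {0..}"
proof -
  define E where "E = {v. \<Phi> 1 v = c *\<^sub>C v}"
  have "\<exists>d\<in>E. \<forall>t\<ge>0. ((\<lambda>t. \<Phi> t v) has_vector_derivative \<Phi> t d) (at t within {0..})" if v: "v \<in> E" for v
  proof -
    obtain h where h: "0 < h"
      "\<And>s v. s \<in> {0..h} \<Longrightarrow> \<Phi> 1 v = c *\<^sub>C v \<Longrightarrow> norm (\<Phi> s v - v) \<le> norm v / 2"
      using uniformly_continuous_at_zero_on_eigenspace[OF K c] by blast
    obtain w where w: "\<Phi> 1 w = c *\<^sub>C w" "v = integral {0..h} (\<lambda>s. \<Phi> s w)"
      using integral_orbit_surj_on_eigenspace[OF h] v unfolding E_def by blast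
    have "\<Phi> 1 (\<Phi> h w) = \<Phi> h (\<Phi> 1 w)"
      using h(1) by (simp add: add[symmetric] add.commute)
    then have "\<Phi> h w - w \<in> E"
      using w(1) h(1) by (simp add: E_def diff scaleC scaleC.diff_right)
    then show ?thesis
      using orbit_integral_has_vector_derivative[of _ h w] h(1) w(2) by auto
  qed
  then obtain D where D: "\<And>v. v \<in> E \<Longrightarrow> D v \<in> E"
    "\<And>v t. v \<in> E \<Longrightarrow> 0 \<le> t \<Longrightarrow> ((\<lambda>t. \<Phi> t v) has_vector_derivative \<Phi> t (D v)) (at t within {0..})"
    by metis
  have iter: "(D ^^ k) v \<in> E" for k
    using v D(1) by (induction k) (auto simp: E_def)
  show ?thesis
    by (rule C_infinity_locI[where g = "\<lambda>k t. \<Phi> t ((D ^^ k) v)"]) (use D(2)[OF iter] in simp_all)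
qed

end

section \<open>Semigroups in discrete time\<close>

context
  fixes \<Phi> :: "real \<Rightarrow> 'a::{complex_normed_vector, banach} \<Rightarrow> 'a"
  assumes semigroup: "strongly_continuous_semigroup \<nat> \<Phi>"
begin

text \<open>The summand \<open>s = t + 1\<close> is split off, and one factor
  \<open>\<Phi> 1\<close> is taken out of all the others.\<close>

lemma discrete_evolution_step:
  assumes ux: "(u, x) \<in> evolution_relation \<nat> \<Phi>" and t: "t \<in> \<nat>"
  shows "x (t + 1) = \<Phi> 1 (x t) + u (t + 1)"
proof -
  \<comment> \<open>Selects the finite sum in \<open>time_integral\<close>; the number 1/2 separates
    the two time domains.\<close>
  have T: "(\<nat> :: real set) \<noteq> {0..}"
  proof
    assume T: "(\<nat> :: real set) = {0..}"
    have "(1 / 2 :: real) \<in> \<nat>"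
      unfolding T by simp
    then obtain n where "1 / 2 = real n" by (rule Nats_cases)
    then have "real 1 = real (2 * n)" by simp
    then have "1 = 2 * n" by (simp only: of_nat_eq_iff)
    then show False by presburger
  qed
  have x: "x r = \<Phi> r (x 0) + (\<Sum>s\<in>\<nat> \<inter> {0<..r}. \<Phi> (r - s) (u s))" if "r \<in> \<nat>" for r
    using ux that T unfolding evolution_relation_def time_integral_def mem_Collect_eq prod.case
    by (simp only: if_False)
  have add: "\<Phi> (r + s) v = \<Phi> r (\<Phi> s v)" if "r \<in> \<nat>" "s \<in> \<nat>" for r s v
    using semigroup that by (simp add: strongly_continuous_semigroup_def)
  have zero: "\<Phi> 0 v = v" for v
    using semigroup by (simp add: strongly_continuous_semigroup_def)
  have lin: "linear (\<Phi> 1)"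
    using semigroup
    by (simp add: strongly_continuous_semigroup_def bounded_clinear_def bounded_linear.linear)
  obtain n where n: "t = real n"
    using t by (rule Nats_cases)
  have "\<nat> \<inter> {0<..t} \<subseteq> real ` {..n}"
    by (auto simp: n elim!: Nats_cases)
  then have fin: "finite (\<nat> \<inter> {0<..t})"
    by (rule finite_subset) simp
  have "\<nat> \<inter> {0<..t + 1} = insert (t + 1) (\<nat> \<inter> {0<..t})"
  proof (intro equalityI subsetI)
    fix s assume "s \<in> \<nat> \<inter> {0<..t + 1}"
    then obtain m where "s = real m" "0 < m" "m \<le> Suc n"
      by (auto simp: n elim!: Nats_cases)
    then show "s \<in> insert (t + 1) (\<nat> \<inter> {0<..t})"
      by (auto simp: n le_Suc_eq)
  qed (use t in \<open>auto simp: n\<close>)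
  then have "(\<Sum>s\<in>\<nat> \<inter> {0<..t + 1}. \<Phi> (t + 1 - s) (u s))
      = u (t + 1) + (\<Sum>s\<in>\<nat> \<inter> {0<..t}. \<Phi> (t + 1 - s) (u s))"
    using fin by (simp add: zero)
  also have "(\<Sum>s\<in>\<nat> \<inter> {0<..t}. \<Phi> (t + 1 - s) (u s)) = (\<Sum>s\<in>\<nat> \<inter> {0<..t}. \<Phi> 1 (\<Phi> (t - s) (u s)))"
  proof (rule sum.cong[OF refl])
    fix s assume s: "s \<in> \<nat> \<inter> {0<..t}"
    then have "t - s \<in> \<nat>"
      using t by (auto elim!: Nats_cases simp: of_nat_diff[symmetric] simp del: of_nat_diff)
    then show "\<Phi> (t + 1 - s) (u s) = \<Phi> 1 (\<Phi> (t - s) (u s))"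
      using add[of 1 "t - s" "u s"] by (simp add: algebra_simps)
  qed
  also have "\<dots> = \<Phi> 1 (\<Sum>s\<in>\<nat> \<inter> {0<..t}. \<Phi> (t - s) (u s))"
    by (rule linear_sum[OF lin, symmetric])
  finally have "(\<Sum>s\<in>\<nat> \<inter> {0<..t + 1}. \<Phi> (t + 1 - s) (u s))
      = u (t + 1) + \<Phi> 1 (\<Sum>s\<in>\<nat> \<inter> {0<..t}. \<Phi> (t - s) (u s))" .
  moreover have "\<Phi> (t + 1) (x 0) = \<Phi> 1 (\<Phi> t (x 0))"
    using add[of 1 t "x 0"] t by (simp add: add.commute)
  moreover have "\<Phi> 1 (x t) = \<Phi> 1 (\<Phi> t (x 0)) + \<Phi> 1 (\<Sum>s\<in>\<nat> \<inter> {0<..t}. \<Phi> (t - s) (u s))"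
    by (subst x[OF t]) (rule linear_add[OF lin])
  moreover have "x (t + 1) = \<Phi> (t + 1) (x 0) + (\<Sum>s\<in>\<nat> \<inter> {0<..t + 1}. \<Phi> (t + 1 - s) (u s))"
    using t by (intro x) simp
  ultimately show ?thesis by simp
qed

text \<open>The forcing term is \<open>u (t + 1)\<close>, shifted by one because the sum runs over
  times in \<open>(0, t]\<close>.\<close>

lemma VIVO_discrete:
  assumes N: "0 < N" and contr: "\<And>v. norm ((\<Phi> 1 ^^ N) v) \<le> norm v / 2"
  shows "VIVO \<nat> (evolution_relation \<nat> \<Phi>)"
proof -
  have "vanishing \<nat> x"
    if ux: "(u, x) \<in> evolution_relation \<nat> \<Phi>" and van: "vanishing \<nat> u" for u x
  proof (rule vanishing_recursion[OF _ _ N contr])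
    show "bounded_linear (\<Phi> 1)"
      using semigroup by (simp add: strongly_continuous_semigroup_def bounded_clinear_def)
    show "x (t + 1) = \<Phi> 1 (x t) + u (t + 1)" if "t \<in> \<nat>" for t
      using ux that by (rule discrete_evolution_step)
    show "vanishing \<nat> (\<lambda>t. u (t + 1))"
      unfolding vanishing_iff
    proof (intro allI impI)
      fix e :: real assume "0 < e"
      then obtain a where a: "\<And>t. t \<in> \<nat> \<Longrightarrow> a \<le> t \<Longrightarrow> norm (u t) < e"
        using van unfolding vanishing_iff by blast
      have "norm (u (t + 1)) < e" if "t \<in> \<nat>" "a \<le> t" for t
        using a[of "t + 1"] that by simp
      then show "\<exists>a. \<forall>t\<in>\<nat>. a \<le> t \<longrightarrow> norm (u (t + 1)) < e"
        by blast
    qed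
    show "\<exists>B. \<forall>t\<in>\<nat>. t \<le> a \<longrightarrow> norm (x t) \<le> B" for a
    proof (intro exI ballI impI)
      fix t :: real assume "t \<in> \<nat>" "t \<le> a"
      then obtain n where "t = real n" "n \<le> nat \<lfloor>a\<rfloor>"
        by (metis Nats_cases le_nat_floor)
      then show "norm (x t) \<le> (\<Sum>k\<le>nat \<lfloor>a\<rfloor>. norm (x (real k)))"
        by (auto intro!: member_le_sum)
    qed
  qed simp
  then show ?thesis
    by (auto simp: VIVO_def)
qed

end

section \<open>Zero input, quasi-periodic trajectories and the equivalence\<close>

lemma vanishing_zero: "vanishing T (\<lambda>_. 0)"
  by (simp add: vanishing_def)

lemma smoothly_vanishing_zero: "smoothly_vanishing T (\<lambda>_. 0 :: 'a::real_normed_vector)"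
proof -
  have "vanishing {0..} (halfline_deriv k (\<lambda>_. 0 :: 'a))" for k
    unfolding vanishing_iff
    using halfline_deriv_eqI[of "\<lambda>_ _. 0 :: 'a" "\<lambda>_. 0"] by auto
  then show ?thesis
    by (simp add: smoothly_vanishing_def vanishing_zero)
qed

lemma smoothly_vanishing_imp_vanishing: "smoothly_vanishing T f \<Longrightarrow> vanishing T f"
  by (auto simp: smoothly_vanishing_def split: if_splits dest: spec[of _ 0])

text \<open>Along the times \<open>t + n\<close> each step multiplies the norm by
  \<open>cmod c \<ge> 1\<close>, so it never falls below \<open>norm (x t)\<close>.\<close>

lemma vanishing_quasi_periodic:
  fixes x :: "real \<Rightarrow> 'a::complex_normed_vector"
  assumes time: "T = {0..} \<or> T = \<nat>"
    and van: "vanishing T x" and c: "1 \<le> cmod c"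
    and x: "\<And>t. t \<in> T \<Longrightarrow> x (t + 1) = c *\<^sub>C x t" and t: "t \<in> T"
  shows "x t = 0"
proof (rule ccontr)
  assume "x t \<noteq> 0"
  then obtain a where a: "\<And>s. s \<in> T \<Longrightarrow> a \<le> s \<Longrightarrow> norm (x s) < norm (x t)"
    using van unfolding vanishing_iff by (meson zero_less_norm_iff)
  have T_add: "t + real n \<in> T" for n
    using time t by auto
  have ge: "norm (x t) \<le> norm (x (t + real n))" for n
  proof (induction n)
    case (Suc n)
    have "norm (x (t + real n)) \<le> cmod c * norm (x (t + real n))"
      using mult_right_mono[OF c norm_ge_zero] by simp
    also have "\<dots> = norm (x (t + real (Suc n)))"
      using x[OF T_add[of n]] by (simp add: norm_scaleC add_ac)
    finally show ?case using Suc by simp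
  qed simp
  obtain n where "a - t \<le> real n"
    using real_arch_simple by blast
  then show False
    using a[OF T_add[of n]] ge[of n] by simp
qed

text \<open>Zero input contributes a zero integral, so the equation is immediate. The content is
  smoothness in continuous time, where compactness and \<open>c \<noteq> 0\<close> enter.\<close>

lemma eigenvector_orbit_in_evolution_relation:
  fixes \<Phi> :: "real \<Rightarrow> 'a::{complex_normed_vector, banach} \<Rightarrow> 'a"
  assumes time: "T = {0..} \<or> T = \<nat>"
    and semigroup: "strongly_continuous_semigroup T \<Phi>"
    and K: "compact_operator (\<Phi> 1)" and c: "c \<noteq> 0" and v: "\<Phi> 1 v = c *\<^sub>C v"
  shows "((\<lambda>_. 0), \<lambda>t. \<Phi> t v) \<in> evolution_relation T \<Phi>"
proof -
  have zero: "\<Phi> (t - s) 0 = 0" if "t \<in> T" "s \<in> T" "s \<le> t" for t s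
  proof -
    have "t - s \<in> T"
      using time that by (auto elim!: Nats_cases simp: of_nat_diff[symmetric] simp del: of_nat_diff)
    then have "linear (\<Phi> (t - s))"
      using semigroup
      by (simp add: strongly_continuous_semigroup_def bounded_clinear_def bounded_linear.linear)
    then show ?thesis by (rule linear_0)
  qed
  have integral_zero: "time_integral T t (\<lambda>s. \<Phi> (t - s) 0) = 0" if t: "t \<in> T" for t
  proof (cases "T = {0..}")
    case True
    have "integral {0<..t} (\<lambda>s. \<Phi> (t - s) 0) = integral {0<..t} (\<lambda>s. 0)"
      using zero t True by (intro integral_cong) auto
    then show ?thesis
      using True by (simp add: time_integral_def)
  next
    case False
    then show ?thesis
      using zero t by (auto simp: time_integral_def intro!: sum.neutral)
  qed
  have smooth: "(\<lambda>t. \<Phi> t v) \<in> C_infinity_loc T"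
  proof (cases "T = {0..}")
    case True
    then interpret halfline_semigroup \<Phi>
      using semigroup by unfold_locales simp
    show ?thesis
      using eigenvector_orbit_smooth[OF K c v] True by simp
  next
    case False
    then show ?thesis by (simp add: C_infinity_loc_def)
  qed
  have "(\<lambda>_. 0 :: 'a) \<in> C_infinity_loc {0..}"
    by (rule C_infinity_locI[of "\<lambda>_ _. 0"]) auto
  then have "(\<lambda>_. 0 :: 'a) \<in> C_infinity_loc T"
    by (cases "T = {0..}") (auto simp: C_infinity_loc_def)
  then show ?thesis
    using smooth integral_zero semigroup
    by (simp add: evolution_relation_def strongly_continuous_semigroup_def)
qed

theorem theorem4p8:
  fixes T :: "real set"
    and \<Phi> :: "real \<Rightarrow> 'a::{complex_normed_vector, banach} \<Rightarrow> 'a"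
    and P :: "((real \<Rightarrow> 'a) \<times> (real \<Rightarrow> 'a)) set"
  assumes time: "T = {0..} \<or> T = \<nat>"
    and semigroup: "strongly_continuous_semigroup T \<Phi>"
    and relation: "P = evolution_relation T \<Phi>"
    and compact: "compact_operator (\<Phi> 1)"
  shows
    "(stable_relation T P \<longleftrightarrow>
       (\<forall>x c. ((\<lambda>_. 0), x) \<in> P \<and> cmod c \<ge> 1 \<and> (\<forall>t\<in>T. x (t + 1) = c *\<^sub>C x t)
          \<longrightarrow> (\<forall>t\<in>T. x t = 0))) \<and>
     ((\<forall>x c. ((\<lambda>_. 0), x) \<in> P \<and> cmod c \<ge> 1 \<and> (\<forall>t\<in>T. x (t + 1) = c *\<^sub>C x t)
          \<longrightarrow> (\<forall>t\<in>T. x t = 0)) \<longleftrightarrow>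
       \<not> (\<exists>c. eigenvalue_of (\<Phi> 1) c \<and> c \<notin> ball 0 1)) \<and>
     (\<not> (\<exists>c. eigenvalue_of (\<Phi> 1) c \<and> c \<notin> ball 0 1) \<longleftrightarrow> VIVO T P) \<and>
     (VIVO T P \<longleftrightarrow> smoothly_VIVO T P)"
    (is "(?a \<longleftrightarrow> ?b) \<and> (?b \<longleftrightarrow> ?c) \<and> (?c \<longleftrightarrow> ?d) \<and> (?d \<longleftrightarrow> ?e)")
proof -
  have "0 \<in> T" "1 \<in> T"
    using time by auto
  \<comment> \<open>The implications \<open>ab\<close>, \<open>bc\<close>, \<open>cd\<close>,
    \<open>de\<close> and \<open>ea\<close> close a cycle.\<close>
  have ab: ?b if ?a
  proof (intro allI impI, elim conjE)
    fix x c
    assume "((\<lambda>_. 0), x) \<in> P" "1 \<le> cmod c" "\<forall>t\<in>T. x (t + 1) = c *\<^sub>C x t"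
    moreover from this have "vanishing T x"
      using \<open>?a\<close> by (simp add: stable_relation_def)
    ultimately show "\<forall>t\<in>T. x t = 0"
      using vanishing_quasi_periodic[OF time, of x c] by blast
  qed
  have bc: ?c if ?b
  proof
    assume "\<exists>c. eigenvalue_of (\<Phi> 1) c \<and> c \<notin> ball 0 1"
    then obtain c v where c: "1 \<le> cmod c" and v: "v \<noteq> 0" "\<Phi> 1 v = c *\<^sub>C v"
      by (auto simp: eigenvalue_of_def not_less)
    \<comment> \<open>The orbit of the eigenvector is a trajectory of the kind that
      \<open>?b\<close> forces to be zero; at time 0 this contradicts
      \<open>v \<noteq> 0\<close>.\<close>
    have "((\<lambda>_. 0), \<lambda>t. \<Phi> t v) \<in> P"
      unfolding relation
      using c v(2) by (intro eigenvector_orbit_in_evolution_relation[OF time semigroup compact, of c]) auto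
    moreover have "\<forall>t\<in>T. \<Phi> (t + 1) v = c *\<^sub>C \<Phi> t v"
      using semigroup \<open>1 \<in> T\<close> v(2)
      by (simp add: strongly_continuous_semigroup_def bounded_clinear_def)
    ultimately have "\<Phi> 0 v = 0"
      using \<open>?b\<close> c \<open>0 \<in> T\<close> by blast
    then show False
      using semigroup v(1) by (simp add: strongly_continuous_semigroup_def)
  qed
  have cd: ?d if ?c
  proof -
    obtain N where "0 < N" "\<And>v. norm ((\<Phi> 1 ^^ N) v) \<le> norm v / 2"
      using compact_operator_contractive_power[OF compact] \<open>?c\<close> by (auto simp: not_less)
    then show ?d
      using time semigroup VIVO_discrete halfline_semigroup.VIVO_halfline halfline_semigroup.intro
      unfolding relation by metis
  qed
  have de: ?e if ?d
  proof (cases "T = {0..}")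
    case True
    then show ?e
      using halfline_semigroup.smoothly_VIVO_halfline halfline_semigroup.intro semigroup \<open>?d\<close>
      unfolding relation by metis
  next
    case False
    then show ?e
      using \<open>?d\<close> by (simp add: VIVO_def smoothly_VIVO_def smoothly_vanishing_def)
  qed
  \<comment> \<open>The zero input is smoothly vanishing, so every response to it is smoothly
    vanishing and in particular vanishing.\<close>
  have ea: ?a if ?e
    using that smoothly_vanishing_zero smoothly_vanishing_imp_vanishing
    by (fastforce simp: stable_relation_def smoothly_VIVO_def)
  show ?thesis
    using ab bc cd de ea by argo
qed

end
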